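(* Let $R$ be a commutative ring with identity, let $A$ be an $R$-algebra, and let $B\subseteq A$ be a commutative subalgebra such that: (WT) if $e\in I(B)\setminus\{0\}$ and $t\in R$ satisfy $te=0$, then $t=0$; $I(B)$ is a set of local units for $A$; and $B=\operatorname{span}_R(I(B))$. Let $\Sigma$ be the groupoid of ultrafilters of $N(B)$, let $G=\Sigma/{\simeq}$ be the quotient of $\Sigma$ by the relation $U\simeq W \iff U=tW$ for some $t\in R^\times$, and let $q\colon\Sigma\to G$ be the quotient map. Define $i\colon G^{(0)}\times R^\times\to\Sigma$ by $i(q(U),t)=tU$ for $U\in\Sigma^{(0)}$ and $t\in R^\times$. Then the sequence $$G^{(0)}\times R^\times\xrightarrow{\ i\ }\Sigma\xrightarrow{\ q\ }G$$ is a discrete $R$-twist over $G$. If, moreover, $(A,B)$ is an algebraic quasi-Cartan pair, then $G$ is Hausdorff.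
   Context: $R^\times$ denotes the group of units of $R$, with the discrete topology. **Normalisers.** $I(B)$ is the set of idempotents of $B$. It is a set of local units for $A$ if for every finite $\{a_1,\dots,a_n\}\subseteq A$ there is $e\in I(B)$ with $ea_i=a_i=a_ie$ for all $i$. The normaliser of $B$ is $N(B)=\{n\in A: \text{there is } k\in A \text{ with } knk=k,\ nkn=n,\ kBn\cup nBk\subseteq B\}$. For $n\in N(B)$ the element $k$ is unique and is denoted $n^\dagger$; $N(B)$ is an inverse semigroup with inverse $n\mapsto n^\dagger$ and idempotent set $I(B)$. Its partial order is: $n\le m$ iff $n=nn^\dagger m$. **The groupoid $\Sigma$.** For $U\subseteq N(B)$ let $U^{\uparrow}=\{m\in N(B): n\le m\text{ for some }n\in U\}$. A filter is a subset $U\subseteq N(B)\setminus\{0\}$ with $U=U^\uparrow$ such that any $m,n\in U$ have some $p\in U$ with $p\le m,n$; an ultrafilter is a maximal filter (ultrafilters are nonempty). $\Sigma$ is the set of ultrafilters, with $U^{-1}=\{n^\dagger:n\in U\}$; $(U,V)$ is composable iff $mn\neq0$ for all $m\in U,n\in V$, and then $UV=\{mn:m\in U,n\in V\}^\uparrow$. One has $s(U)=U^{-1}U$, $r(U)=UU^{-1}$, and $\Sigma^{(0)}=\{U\in\Sigma:U\cap I(B)\ne\varnothing\}$. The sets $\mathcal V_n=\{U\in\Sigma:n\in U\}$, $n\in N(B)$, form a basis for the topology on $\Sigma$. For $t\in R^\times$ and $U\in\Sigma$, $tU=\{tm:m\in U\}\in\Sigma$. **The groupoid $G$.** $G=\Sigma/{\simeq}$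 has the quotient topology and the groupoid structure $q(U)^{-1}=q(U^{-1})$, $G^{(2)}=\{(q(U),q(W)):(U,W)\in\Sigma^{(2)}\}$, $q(U)q(W)=q(UW)$ for $(U,W)\in\Sigma^{(2)}$; $q$ restricts to a bijection $\Sigma^{(0)}\to G^{(0)}$. **Twists.** A topological groupoid is étale if its range map is a local homeomorphism. A bisection is a subset $D$ contained in an open set $O$ such that $r|_O$ and $s|_O$ are homeomorphisms onto open subsets of the unit space. A discrete $R$-twist over an étale groupoid $G$ (with Hausdorff unit space) is a sequence $G^{(0)}\times R^\times\xrightarrow{i}\Sigma\xrightarrow{q}G$, where $G^{(0)}\times R^\times$ is the trivial group bundle, $\Sigma$ is a topological groupoid with $\Sigma^{(0)}=i(G^{(0)}\times\{1\})$, and $i,q$ are continuous groupoid homomorphisms restricting to homeomorphisms of unit spaces, such that: (DT1) $i(\{x\}\times R^\times)=q^{-1}(x)$ for all $x\in G^{(0)}$, $i$ is injective, $q$ is surjective; (DT2) each $\alpha\in G$ has an open bisection $B_\alpha\ni\alpha$ and a continuous $P_\alpha\colon B_\alpha\to\Sigma$ with $q\circ P_\alpha=\mathrm{id}$ and $(\beta,t)\mapsto i(r(\beta),t)P_\alpha(\beta)$ a homeomorphism $B_\alpha\times R^\times\to q^{-1}(B_\alpha)$; (DT3) $i(r(\sigma),t)\sigma=\sigma\,i(s(\sigma),t)$ for all $\sigma\in\Sigma$, $t\in R^\times$ (units of $\Sigma$ and $G$ being identified). **Algebraic quasi-Cartan pairs.** A conditional expectation $P\colon A\to B$ is an $R$-linear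 map with $P|_B=\mathrm{id}_B$ and $P(bab')=bP(a)b'$ for $a\in A$, $b,b'\in B$. It is faithful if for every $a\in A\setminus\{0\}$ there is $n\in N(B)$ with $P(na)\ne0$, and implemented by idempotents if for every $n\in N(B)$ there is $e\in I(B)$ with $P(n)=ne=en$. $(A,B)$ is an algebraic quasi-Cartan pair if $B$ is commutative and satisfies (WT), $I(B)$ is a set of local units for $A$, $B=\operatorname{span}_R I(B)$, $A=\operatorname{span}_R N(B)$, and there is a faithful conditional expectation $P\colon A\to B$ that is implemented by idempotents. *)

theory Defs
  imports "HOL-Analysis.Analysis"
begin

section \<open>Algebras and their subalgebras\<close>

text \<open>
  The sort of the scalars is that of a commutative ring with identity in which \<open>0 = 1\<close> is not
  excluded. The class \<^class>\<open>comm_ring_1\<close>, and with it the locale \<^locale>\<open>module\<close>, would exclude the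
  zero ring. The algebra need not have an identity.
\<close>

locale r_algebra =
  fixes smul :: "'r::{comm_ring,comm_monoid_mult} \<Rightarrow> 'a::ring \<Rightarrow> 'a"
  assumes scale_right_distrib: "smul t (a + b) = smul t a + smul t b"
    and scale_left_distrib: "smul (t + u) a = smul t a + smul u a"
    and scale_scale: "smul t (smul u a) = smul (t * u) a"
    and scale_one: "smul 1 a = a"
    and scale_mult_left: "smul t a * b = smul t (a * b)"
    and scale_mult_right: "a * smul t b = smul t (a * b)"

definition unit_group :: "'r::{comm_ring,comm_monoid_mult} set" where
  "unit_group = {t. t dvd 1}"

definition unit_inv :: "'r::{comm_ring,comm_monoid_mult} \<Rightarrow> 'r" where
  "unit_inv t = (THE u. t * u = 1)"

definition r_span :: "('r::{comm_ring,comm_monoid_mult} \<Rightarrow> 'a::ring \<Rightarrow> 'a) \<Rightarrow> 'a set \<Rightarrow> 'a set" where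
  "r_span smul S = {(\<Sum>a\<in>F. smul (c a) a) | F c. finite F \<and> F \<subseteq> S}"

definition commutative_subalgebra ::
    "('r::{comm_ring,comm_monoid_mult} \<Rightarrow> 'a::ring \<Rightarrow> 'a) \<Rightarrow> 'a set \<Rightarrow> bool" where
  "commutative_subalgebra smul B \<longleftrightarrow>
     0 \<in> B \<and>
     (\<forall>a\<in>B. \<forall>b\<in>B. a + b \<in> B \<and> a * b \<in> B \<and> a * b = b * a) \<and>
     (\<forall>t. \<forall>b\<in>B. smul t b \<in> B)"

definition idems :: "'a::ring set \<Rightarrow> 'a set" where
  "idems B = {e \<in> B. e * e = e}"

definition WT :: "('r::{comm_ring,comm_monoid_mult} \<Rightarrow> 'a::ring \<Rightarrow> 'a) \<Rightarrow> 'a set \<Rightarrow> bool" where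
  "WT smul B \<longleftrightarrow> (\<forall>e\<in>idems B - {0}. \<forall>t. smul t e = 0 \<longrightarrow> t = 0)"

definition local_units :: "'a::ring set \<Rightarrow> bool" where
  "local_units E \<longleftrightarrow> (\<forall>F. finite F \<longrightarrow> (\<exists>e\<in>E. \<forall>a\<in>F. e * a = a \<and> a * e = a))"


section \<open>Normalisers\<close>

definition normal_inverse :: "'a::ring set \<Rightarrow> 'a \<Rightarrow> 'a \<Rightarrow> bool" where
  "normal_inverse B n k \<longleftrightarrow>
     k * n * k = k \<and> n * k * n = n \<and> (\<forall>b\<in>B. k * b * n \<in> B \<and> n * b * k \<in> B)"

definition normaliser :: "'a::ring set \<Rightarrow> 'a set" where
  "normaliser B = {n. \<exists>k. normal_inverse B n k}"

definition dagger :: "'a::ring set \<Rightarrow> 'a \<Rightarrow> 'a" where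
  "dagger B n = (THE k. normal_inverse B n k)"

definition nle :: "'a::ring set \<Rightarrow> 'a \<Rightarrow> 'a \<Rightarrow> bool" where
  "nle B n m \<longleftrightarrow> n = n * dagger B n * m"

definition up :: "'a::ring set \<Rightarrow> 'a set \<Rightarrow> 'a set" where
  "up B U = {m \<in> normaliser B. \<exists>n\<in>U. nle B n m}"

definition nfilter :: "'a::ring set \<Rightarrow> 'a set \<Rightarrow> bool" where
  "nfilter B U \<longleftrightarrow>
     U \<subseteq> normaliser B - {0} \<and> U = up B U \<and>
     (\<forall>m\<in>U. \<forall>n\<in>U. \<exists>p\<in>U. nle B p m \<and> nle B p n)"

text \<open>
  The empty set is a filter by the preceding definition, and it is the only one if \<open>0\<close> is the only
  normaliser; ultrafilters have to be nonempty.
\<close>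

definition ultrafilters :: "'a::ring set \<Rightarrow> 'a set set" where
  "ultrafilters B = {U. nfilter B U \<and> U \<noteq> {} \<and> (\<forall>V. nfilter B V \<and> U \<subseteq> V \<longrightarrow> V = U)}"


section \<open>Algebraic quasi-Cartan pairs\<close>

definition conditional_expectation ::
    "('r::{comm_ring,comm_monoid_mult} \<Rightarrow> 'a::ring \<Rightarrow> 'a) \<Rightarrow> 'a set \<Rightarrow> ('a \<Rightarrow> 'a) \<Rightarrow> bool" where
  "conditional_expectation smul B P \<longleftrightarrow>
     range P \<subseteq> B \<and>
     (\<forall>a a'. P (a + a') = P a + P a') \<and> (\<forall>t a. P (smul t a) = smul t (P a)) \<and>
     (\<forall>b\<in>B. P b = b) \<and>
     (\<forall>a. \<forall>b\<in>B. \<forall>b'\<in>B. P (b * a * b') = b * P a * b')"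

definition faithful_expectation :: "'a::ring set \<Rightarrow> ('a \<Rightarrow> 'a) \<Rightarrow> bool" where
  "faithful_expectation B P \<longleftrightarrow> (\<forall>a. a \<noteq> 0 \<longrightarrow> (\<exists>n\<in>normaliser B. P (n * a) \<noteq> 0))"

definition implemented_by_idempotents :: "'a::ring set \<Rightarrow> ('a \<Rightarrow> 'a) \<Rightarrow> bool" where
  "implemented_by_idempotents B P \<longleftrightarrow>
     (\<forall>n\<in>normaliser B. \<exists>e\<in>idems B. P n = n * e \<and> n * e = e * n)"

definition algebraic_quasi_Cartan_pair ::
    "('r::{comm_ring,comm_monoid_mult} \<Rightarrow> 'a::ring \<Rightarrow> 'a) \<Rightarrow> 'a set \<Rightarrow> bool" where
  "algebraic_quasi_Cartan_pair smul B \<longleftrightarrow>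
     r_algebra smul \<and> commutative_subalgebra smul B \<and> WT smul B \<and>
     local_units (idems B) \<and>
     B = r_span smul (idems B) \<and>
     UNIV = r_span smul (normaliser B) \<and>
     (\<exists>P. conditional_expectation smul B P \<and> faithful_expectation B P \<and>
          implemented_by_idempotents B P)"


section \<open>Topological groupoids\<close>

record 'g groupoid_struct =
  arrows :: "'g set"
  composables :: "('g \<times> 'g) set"
  gmult :: "'g \<Rightarrow> 'g \<Rightarrow> 'g"
  ginv :: "'g \<Rightarrow> 'g"

record 'g topgroupoid_struct = "'g groupoid_struct" +
  gtop :: "'g topology"

definition gsource :: "('g, 'm) groupoid_struct_scheme \<Rightarrow> 'g \<Rightarrow> 'g" where
  "gsource G g = gmult G (ginv G g) g"

definition grange :: "('g, 'm) groupoid_struct_scheme \<Rightarrow> 'g \<Rightarrow> 'g" where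
  "grange G g = gmult G g (ginv G g)"

definition gunits :: "('g, 'm) groupoid_struct_scheme \<Rightarrow> 'g set" where
  "gunits G = gsource G ` arrows G"

locale groupoid =
  fixes G :: "('g, 'm) groupoid_struct_scheme"
  assumes composables_subset: "composables G \<subseteq> arrows G \<times> arrows G"
    and mult_closed: "(g, h) \<in> composables G \<Longrightarrow> gmult G g h \<in> arrows G"
    and inv_closed: "g \<in> arrows G \<Longrightarrow> ginv G g \<in> arrows G"
    and inv_inv: "g \<in> arrows G \<Longrightarrow> ginv G (ginv G g) = g"
    and assoc_composable: "(g, h) \<in> composables G \<Longrightarrow> (h, k) \<in> composables G \<Longrightarrow>
          (gmult G g h, k) \<in> composables G \<and> (g, gmult G h k) \<in> composables G"
    and assoc: "(g, h) \<in> composables G \<Longrightarrow> (h, k) \<in> composables G \<Longrightarrow>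
          gmult G (gmult G g h) k = gmult G g (gmult G h k)"
    and inv_composable: "g \<in> arrows G \<Longrightarrow>
          (ginv G g, g) \<in> composables G \<and> (g, ginv G g) \<in> composables G"
    and inv_mult_cancel: "(g, h) \<in> composables G \<Longrightarrow> gmult G (ginv G g) (gmult G g h) = h"
    and mult_inv_cancel: "(g, h) \<in> composables G \<Longrightarrow> gmult G (gmult G g h) (ginv G h) = g"

definition groupoid_hom ::
    "('g \<Rightarrow> 'h) \<Rightarrow> ('g, 'm) groupoid_struct_scheme \<Rightarrow> ('h, 'n) groupoid_struct_scheme \<Rightarrow> bool" where
  "groupoid_hom f G H \<longleftrightarrow>
     f ` arrows G \<subseteq> arrows H \<and>
     (\<forall>(g, h)\<in>composables G.
        (f g, f h) \<in> composables H \<and> f (gmult G g h) = gmult H (f g) (f h))"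

locale topological_groupoid = groupoid G
  for G :: "('g, 'm) topgroupoid_struct_scheme" +
  assumes topspace_gtop: "topspace (gtop G) = arrows G"
    and continuous_mult:
      "continuous_map (subtopology (prod_topology (gtop G) (gtop G)) (composables G)) (gtop G)
         (\<lambda>(g, h). gmult G g h)"
    and continuous_inv: "continuous_map (gtop G) (gtop G) (ginv G)"

definition unit_space :: "('g, 'm) topgroupoid_struct_scheme \<Rightarrow> 'g topology" where
  "unit_space G = subtopology (gtop G) (gunits G)"

definition local_homeo :: "'x topology \<Rightarrow> 'y topology \<Rightarrow> ('x \<Rightarrow> 'y) \<Rightarrow> bool" where
  "local_homeo X Y f \<longleftrightarrow>
     (\<forall>x\<in>topspace X. \<exists>U. x \<in> U \<and> openin X U \<and> openin Y (f ` U) \<and>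
        homeomorphic_map (subtopology X U) (subtopology Y (f ` U)) f)"

definition etale_groupoid :: "('g, 'm) topgroupoid_struct_scheme \<Rightarrow> bool" where
  "etale_groupoid G \<longleftrightarrow>
     topological_groupoid G \<and> local_homeo (gtop G) (unit_space G) (grange G)"

definition bisection :: "('g, 'm) topgroupoid_struct_scheme \<Rightarrow> 'g set \<Rightarrow> bool" where
  "bisection G D \<longleftrightarrow>
     (\<exists>W. D \<subseteq> W \<and> openin (gtop G) W \<and>
        (\<forall>f\<in>{grange G, gsource G}.
           openin (unit_space G) (f ` W) \<and>
           homeomorphic_map (subtopology (gtop G) W) (subtopology (unit_space G) (f ` W)) f))"


section \<open>Discrete twists\<close>

definition unit_bundle ::
    "('g, 'm) topgroupoid_struct_scheme \<Rightarrow>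
     ('g \<times> 'r::{comm_ring,comm_monoid_mult}) topgroupoid_struct" where
  "unit_bundle G =
     \<lparr>arrows = gunits G \<times> unit_group,
      composables = {((x, t), (y, u)) | x t y u.
        x \<in> gunits G \<and> y = x \<and> t \<in> unit_group \<and> u \<in> unit_group},
      gmult = (\<lambda>(x, t) (y, u). (x, t * u)),
      ginv = (\<lambda>(x, t). (x, unit_inv t)),
      gtop = prod_topology (unit_space G) (discrete_topology unit_group)\<rparr>"

text \<open>
  The units of \<open>E\<close> and \<open>G\<close> are identified along \<open>q\<close>, so that \<open>i (r \<sigma>, t)\<close> for an arrow \<open>\<sigma>\<close> of \<open>E\<close>
  becomes \<open>i (q (r \<sigma>), t)\<close>.
\<close>

definition discrete_twist ::
    "('g \<times> 'r::{comm_ring,comm_monoid_mult} \<Rightarrow> 'e) \<Rightarrow> ('e, 'm) topgroupoid_struct_scheme \<Rightarrow>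
     ('e \<Rightarrow> 'g) \<Rightarrow> ('g, 'n) topgroupoid_struct_scheme \<Rightarrow> bool" where
  "discrete_twist i E q G \<longleftrightarrow>
     etale_groupoid G \<and> Hausdorff_space (unit_space G) \<and>
     topological_groupoid E \<and> gunits E = i ` (gunits G \<times> {1}) \<and>
     groupoid_hom i (unit_bundle G) E \<and> continuous_map (gtop (unit_bundle G)) (gtop E) i \<and>
     homeomorphic_map (unit_space (unit_bundle G)) (unit_space E) i \<and>
     groupoid_hom q E G \<and> continuous_map (gtop E) (gtop G) q \<and>
     homeomorphic_map (unit_space E) (unit_space G) q \<and>
     (\<forall>x\<in>gunits G. i ` ({x} \<times> unit_group) = {\<sigma> \<in> arrows E. q \<sigma> = x}) \<and>
     inj_on i (gunits G \<times> unit_group) \<and> q ` arrows E = arrows G \<and>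
     (\<forall>\<alpha>\<in>arrows G. \<exists>D P.
        \<alpha> \<in> D \<and> openin (gtop G) D \<and> bisection G D \<and>
        continuous_map (subtopology (gtop G) D) (gtop E) P \<and>
        (\<forall>\<beta>\<in>D. q (P \<beta>) = \<beta>) \<and>
        homeomorphic_map
          (prod_topology (subtopology (gtop G) D) (discrete_topology unit_group))
          (subtopology (gtop E) {\<sigma> \<in> arrows E. q \<sigma> \<in> D})
          (\<lambda>(\<beta>, t). gmult E (i (grange G \<beta>, t)) (P \<beta>))) \<and>
     (\<forall>\<sigma>\<in>arrows E. \<forall>t\<in>unit_group.
        gmult E (i (q (grange E \<sigma>), t)) \<sigma> = gmult E \<sigma> (i (q (gsource E \<sigma>), t)))"


section \<open>The groupoid of ultrafilters and its quotient\<close>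

text \<open>
  As ultrafilters are down-directed, the generating sets below form a basis of the topology and
  not merely a subbasis; as ultrafilters are nonempty, they cover all ultrafilters.
\<close>

definition Sigma_groupoid :: "'a::ring set \<Rightarrow> 'a set topgroupoid_struct" where
  "Sigma_groupoid B =
     \<lparr>arrows = ultrafilters B,
      composables = {(U, V). U \<in> ultrafilters B \<and> V \<in> ultrafilters B \<and>
        (\<forall>m\<in>U. \<forall>n\<in>V. m * n \<noteq> 0)},
      gmult = (\<lambda>U V. up B {m * n | m n. m \<in> U \<and> n \<in> V}),
      ginv = (\<lambda>U. dagger B ` U),
      gtop = topology_generated_by ((\<lambda>n. {U \<in> ultrafilters B. n \<in> U}) ` normaliser B)\<rparr>"

definition usim ::
    "('r::{comm_ring,comm_monoid_mult} \<Rightarrow> 'a::ring \<Rightarrow> 'a) \<Rightarrow> 'a set \<Rightarrow> ('a set \<times> 'a set) set" where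
  "usim smul B = {(U, W). U \<in> ultrafilters B \<and> W \<in> ultrafilters B \<and>
     (\<exists>t\<in>unit_group. U = smul t ` W)}"

definition Gq ::
    "('r::{comm_ring,comm_monoid_mult} \<Rightarrow> 'a::ring \<Rightarrow> 'a) \<Rightarrow> 'a set \<Rightarrow> 'a set \<Rightarrow> 'a set set" where
  "Gq smul B U = usim smul B `` {U}"

definition quotient_top :: "'x topology \<Rightarrow> ('x \<Rightarrow> 'y) \<Rightarrow> 'y topology" where
  "quotient_top X f =
     topology (\<lambda>V. V \<subseteq> f ` topspace X \<and> openin X {x \<in> topspace X. f x \<in> V})"

lemma openin_quotient_top:
  "openin (quotient_top X f) V \<longleftrightarrow> V \<subseteq> f ` topspace X \<and> openin X {x \<in> topspace X. f x \<in> V}"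
proof -
  have "istopology (\<lambda>V. V \<subseteq> f ` topspace X \<and> openin X {x \<in> topspace X. f x \<in> V})"
    unfolding istopology_def
  proof (intro conjI allI impI)
    fix S T
    assume S: "S \<subseteq> f ` topspace X \<and> openin X {x \<in> topspace X. f x \<in> S}"
      and T: "T \<subseteq> f ` topspace X \<and> openin X {x \<in> topspace X. f x \<in> T}"
    then show "S \<inter> T \<subseteq> f ` topspace X" by blast
    have "{x \<in> topspace X. f x \<in> S \<inter> T} = {x \<in> topspace X. f x \<in> S} \<inter> {x \<in> topspace X. f x \<in> T}"
      by blast
    with S T show "openin X {x \<in> topspace X. f x \<in> S \<inter> T}" by auto
  next
    fix K
    assume K: "\<forall>V\<in>K. V \<subseteq> f ` topspace X \<and> openin X {x \<in> topspace X. f x \<in> V}"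
    then show "\<Union>K \<subseteq> f ` topspace X" by blast
    have "{x \<in> topspace X. f x \<in> \<Union>K} = (\<Union>V\<in>K. {x \<in> topspace X. f x \<in> V})" by blast
    with K show "openin X {x \<in> topspace X. f x \<in> \<Union>K}" by auto
  qed
  then show ?thesis by (simp add: quotient_top_def topology_inverse')
qed

lemma quotient_map_quotient_top: "quotient_map X (quotient_top X f) f"
proof -
  have "openin (quotient_top X f) (f ` topspace X)"
    by (auto simp: openin_quotient_top intro: back_subst[where P = "openin X", OF openin_topspace])
  then have "topspace (quotient_top X f) = f ` topspace X"
    by (metis openin_quotient_top openin_subset openin_topspace subset_antisym)
  then show ?thesis
    by (auto simp: quotient_map_def openin_quotient_top)
qed

text \<open>
  Product and inverse of classes are described through arbitrary representatives. That these
  descriptions do not depend on the representatives is part of what has to be shown for \<open>G\<close> to be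
  a groupoid; the same applies to the map \<open>i\<close> below.
\<close>

definition G_groupoid ::
    "('r::{comm_ring,comm_monoid_mult} \<Rightarrow> 'a::ring \<Rightarrow> 'a) \<Rightarrow> 'a set \<Rightarrow>
     'a set set topgroupoid_struct" where
  "G_groupoid smul B = (let S = Sigma_groupoid B; q = Gq smul B in
     \<lparr>arrows = arrows S // usim smul B,
      composables = map_prod q q ` composables S,
      gmult = (\<lambda>x y. THE z. \<exists>U W. (U, W) \<in> composables S \<and> q U = x \<and> q W = y \<and>
        z = q (gmult S U W)),
      ginv = (\<lambda>x. THE z. \<exists>U\<in>arrows S. q U = x \<and> z = q (ginv S U)),
      gtop = quotient_top (gtop S) q\<rparr>)"

definition Gi ::
    "('r::{comm_ring,comm_monoid_mult} \<Rightarrow> 'a::ring \<Rightarrow> 'a) \<Rightarrow> 'a set \<Rightarrow> 'a set set \<times> 'r \<Rightarrow> 'a set" where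
  "Gi smul B = (\<lambda>(x, t).
     smul t ` (THE U. U \<in> gunits (Sigma_groupoid B) \<and> Gq smul B U = x))"

end

theory Submission
  imports Defs
begin

text \<open>
  The whole argument rests on reading an ultrafilter as a germ. The idempotents of \<open>B\<close> form a
  generalised Boolean algebra, with relative complements \<open>e - e * f\<close>; call its ultrafilters points. An
  ultrafilter \<open>U\<close> of normalisers has a source point \<open>sp U\<close>, the idempotents that fix some member of \<open>U\<close>
  from the right, and is recovered from it and any single member \<open>n\<close>: it consists of the normalisers
  that agree with \<open>n\<close> after multiplication by some \<open>f\<close> in \<open>sp U\<close> (\<open>UF_eq_germ\<close>). Conversely, \<open>n\<close> and a
  point \<open>x\<close> containing \<open>n\<^sup>\<dagger> * n\<close> determine such a germ, and every such germ is an ultrafilter (\<open>germ_UF\<close>). So two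
  ultrafilters coincide as soon as they have the same source point and a common member (\<open>UF_eqI\<close>).

  In these terms \<open>U\<close> and \<open>V\<close> are composable iff the source point of \<open>U\<close> is the range point of \<open>V\<close>, and
  their product is the germ of \<open>n * m\<close> at \<open>sp V\<close> for any \<open>n \<in> U\<close>, \<open>m \<in> V\<close>. All groupoid identities then
  reduce to naming a common member. Scalar units leave source and range points unchanged, which is why
  the groupoid structure descends to the quotient, and they act by homeomorphisms, which is why the
  quotient map \<open>q\<close> is open.

  Write \<open>cyl n\<close> for the basic open set of the ultrafilters that contain \<open>n\<close>. An element of \<open>cyl n\<close> is
  determined by its source point, and also by its range point. Hence source and range of the quotient,
  which are open maps, are injective on the open sets \<open>q ` cyl n\<close>, which makes the quotient etale, and \<open>q\<close> is injective on
  \<open>cyl n\<close>, so that its inverse is a continuous section over \<open>q ` cyl n\<close>. By (WT) the scalar action is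
  free (\<open>sact_free\<close>); translating the section by scalars therefore trivialises \<open>q\<close> over \<open>q ` cyl n\<close>.

  For the Hausdorff property the critical pair is that of two ultrafilters \<open>U\<close>, \<open>W\<close> with the same source
  and the same range point. Put \<open>k = n\<^sup>\<dagger> * m\<close> with \<open>n \<in> U\<close>, \<open>m \<in> W\<close>, and let \<open>P k = k * e\<close> with an idempotent
  \<open>e\<close>. If \<open>e\<close> lies in the source point, then the product of the inverse of \<open>U\<close> with \<open>W\<close> contains
  \<open>k * e \<in> B\<close>, which locally is a scalar multiple of an idempotent; the scalar must be a unit, and \<open>U\<close>, \<open>W\<close> have the same class. Otherwise the source point
  contains an idempotent \<open>g\<close> orthogonal to \<open>e\<close>, so that \<open>P\<close> vanishes on \<open>k * g\<close>, whereas it would not if an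
  ultrafilter containing \<open>n * g\<close> were a scalar multiple of one containing \<open>m * g\<close>; so \<open>n * g\<close> and \<open>m * g\<close> define
  disjoint neighbourhoods (\<open>separate_parallel\<close>).
\<close>

locale local_unit_subring =
  fixes B :: "'a::ring set"
  assumes zero_B: "0 \<in> B"
    and add_B: "a \<in> B \<Longrightarrow> b \<in> B \<Longrightarrow> a + b \<in> B"
    and uminus_B: "a \<in> B \<Longrightarrow> - a \<in> B"
    and mult_B: "a \<in> B \<Longrightarrow> b \<in> B \<Longrightarrow> a * b \<in> B"
    and commute_B: "a \<in> B \<Longrightarrow> b \<in> B \<Longrightarrow> a * b = b * a"
    and local_units_B: "local_units (idems B)"
begin

abbreviation I :: "'a set" where "I \<equiv> idems B"
abbreviation N :: "'a set" where "N \<equiv> normaliser B"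
abbreviation UF :: "'a set set" where "UF \<equiv> ultrafilters B"
abbreviation dag :: "'a \<Rightarrow> 'a" ("_\<^sup>\<dagger>" [1000] 1000) where "n\<^sup>\<dagger> \<equiv> dagger B n"

section \<open>The inverse semigroup of normalisers\<close>

lemma I_D: assumes "e \<in> I" shows "e \<in> B" "e * e = e"
  using assms by (auto simp: idems_def)

lemma I_idem_right: "e \<in> I \<Longrightarrow> a * e * e = a * e"
  by (metis I_D(2) mult.assoc)

lemma I_idem_left: "e \<in> I \<Longrightarrow> e * (e * a) = e * a"
  by (metis I_D(2) mult.assoc)

lemma I_commute: "e \<in> I \<Longrightarrow> f \<in> I \<Longrightarrow> e * f = f * e"
  using commute_B I_D(1) by blast

lemma I_right_commute: "e \<in> I \<Longrightarrow> f \<in> I \<Longrightarrow> a * e * f = a * f * e"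
  by (metis I_commute mult.assoc)

lemma zero_I: "0 \<in> I"
  by (simp add: idems_def zero_B)

lemma mult_I: assumes "e \<in> I" "f \<in> I" shows "e * f \<in> I"
proof -
  have "e * f * (e * f) = e * (f * e) * f" by (simp add: mult.assoc)
  also have "\<dots> = e * (e * f) * f" using assms I_commute by simp
  also have "\<dots> = e * f" using assms by (simp add: I_D mult.assoc[symmetric] I_idem_right)
  finally show ?thesis using assms by (simp add: idems_def mult_B)
qed

lemma diff_I: assumes "e \<in> I" "f \<in> I" shows "e - e * f \<in> I"
proof -
  have "e - e * f \<in> B"
    using assms add_B[of e "- (e * f)"] by (simp add: uminus_B mult_B I_D)
  moreover have "e * f * e = e * f"
    using assms by (metis I_D(2) I_commute mult.assoc)
  ultimately show ?thesis
    using assms mult_I[OF assms] by (simp add: idems_def algebra_simps I_idem_left)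
qed

lemma diff_I_annihilates: assumes "e \<in> I" "f \<in> I"
  shows "(e - e * f) * f = 0" "f * (e - e * f) = 0"
proof -
  show *: "(e - e * f) * f = 0" using assms by (simp add: algebra_simps I_D)
  show "f * (e - e * f) = 0" using * I_commute[OF assms(2) diff_I[OF assms]] by simp
qed

lemma local_unit: obtains e where "e \<in> I" "e * a = a" "a * e = a" "e * b = b" "b * e = b"
proof -
  have "finite {a, b}" by simp
  with local_units_B show ?thesis using that unfolding local_units_def
    by (metis insertI1 insertI2)
qed

text \<open>
  A local unit for \<open>n\<close> and \<open>k\<close> can be inserted between them, and conjugation preserves \<open>B\<close>; this is how
  the products land in \<open>B\<close> although \<open>B\<close> has no identity.
\<close>

lemma normal_inverse_idem:
  assumes "normal_inverse B n k" shows "k * n \<in> I" "n * k \<in> I"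
proof -
  obtain e where e: "e \<in> I" "e * n = n" "e * k = k" by (rule local_unit[of n k])
  have "k * e * n \<in> B" "n * e * k \<in> B" using assms e(1) by (auto simp: normal_inverse_def I_D)
  then show "k * n \<in> I" "n * k \<in> I"
    using assms e by (auto simp: normal_inverse_def idems_def mult.assoc)
qed

text \<open>
  The usual inverse semigroup argument: both inverses equal \<open>k * n * l\<close> because the idempotents
  \<open>n * k\<close>, \<open>n * l\<close> commute, and so do \<open>k * n\<close>, \<open>l * n\<close>.
\<close>

lemma normal_inverse_unique:
  assumes k: "normal_inverse B n k" and l: "normal_inverse B n l" shows "k = l"
proof -
  note I = normal_inverse_idem[OF k] normal_inverse_idem[OF l]
  have eqs: "k * n * k = k" "n * k * n = n" "l * n * l = l" "n * l * n = n"
    using k l by (auto simp: normal_inverse_def)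
  have "k = k * (n * l * n) * k" using eqs by simp
  also have "\<dots> = k * ((n * l) * (n * k))" by (simp add: mult.assoc)
  also have "\<dots> = k * ((n * k) * (n * l))" using I I_commute by simp
  also have "\<dots> = k * n * k * n * l" by (simp add: mult.assoc)
  also have "\<dots> = k * n * l" using eqs by simp
  finally have "k = k * n * l" .
  moreover have "l = l * (n * k * n) * l" using eqs by simp
  then have "l = (l * n) * (k * n) * l" by (simp add: mult.assoc)
  then have "l = (k * n) * (l * n) * l" using I I_commute by simp
  then have "l = k * (n * l * n) * l" by (simp add: mult.assoc)
  then have "l = k * n * l" using eqs by simp
  ultimately show ?thesis by simp
qed

lemma dagger_eqI: "normal_inverse B n k \<Longrightarrow> n\<^sup>\<dagger> = k"
  unfolding dagger_def using normal_inverse_unique by blast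

lemma normal_inverse_dagger: "n \<in> N \<Longrightarrow> normal_inverse B n (n\<^sup>\<dagger>)"
  using dagger_eqI by (auto simp: normaliser_def)

lemma normal_inverse_sym: "normal_inverse B n k \<Longrightarrow> normal_inverse B k n"
  by (auto simp: normal_inverse_def)

lemma normal_inverse_N: "normal_inverse B n k \<Longrightarrow> n \<in> N"
  by (auto simp: normaliser_def)

lemma dagger_N: "n \<in> N \<Longrightarrow> n\<^sup>\<dagger> \<in> N"
  using normal_inverse_dagger normal_inverse_sym normal_inverse_N by blast

lemma dagger_dagger: "n \<in> N \<Longrightarrow> n\<^sup>\<dagger>\<^sup>\<dagger> = n"
  using normal_inverse_dagger normal_inverse_sym dagger_eqI by blast

lemma dagger_mult_cancel: assumes "n \<in> N"
  shows "n\<^sup>\<dagger> * n * n\<^sup>\<dagger> = n\<^sup>\<dagger>" "n * n\<^sup>\<dagger> * n = n" "n * (n\<^sup>\<dagger> * n) = n" "n\<^sup>\<dagger> * (n * n\<^sup>\<dagger>) = n\<^sup>\<dagger>"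
  using normal_inverse_dagger[OF assms] by (auto simp: normal_inverse_def mult.assoc)

lemma dagger_I: assumes "n \<in> N" shows "n\<^sup>\<dagger> * n \<in> I" "n * n\<^sup>\<dagger> \<in> I"
  using normal_inverse_idem[OF normal_inverse_dagger[OF assms]] by auto

lemma normal_inverse_mult:
  assumes n: "normal_inverse B n k" and m: "normal_inverse B m l"
  shows "normal_inverse B (n * m) (l * k)"
proof -
  have eqs: "k * n * k = k" "n * k * n = n" "m * l * m = m" "l * m * l = l"
    using n m by (auto simp: normal_inverse_def)
  have com: "(k * n) * (m * l) = (m * l) * (k * n)"
    using n m normal_inverse_idem I_commute by blast
  have "l * k * (n * m) * (l * k) = l * ((k * n) * (m * l)) * k" by (simp add: mult.assoc)
  also have "\<dots> = (l * m * l) * (k * n * k)" unfolding com by (simp add: mult.assoc)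
  finally have 1: "l * k * (n * m) * (l * k) = l * k" using eqs by simp
  have "n * m * (l * k) * (n * m) = n * ((m * l) * (k * n)) * m" by (simp add: mult.assoc)
  also have "\<dots> = (n * k * n) * (m * l * m)" unfolding com[symmetric] by (simp add: mult.assoc)
  finally have 2: "n * m * (l * k) * (n * m) = n * m" using eqs by simp
  have "l * (k * b * n) * m \<in> B" "n * (m * b * l) * k \<in> B" if "b \<in> B" for b
    using that n m by (auto simp: normal_inverse_def)
  with 1 2 show ?thesis by (auto simp: normal_inverse_def mult.assoc)
qed

lemma mult_N: "n \<in> N \<Longrightarrow> m \<in> N \<Longrightarrow> n * m \<in> N"
  using normal_inverse_dagger normal_inverse_mult normal_inverse_N by blast

lemma dagger_mult: "n \<in> N \<Longrightarrow> m \<in> N \<Longrightarrow> (n * m)\<^sup>\<dagger> = m\<^sup>\<dagger> * n\<^sup>\<dagger>"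
  using normal_inverse_dagger normal_inverse_mult dagger_eqI by blast

lemma normal_inverse_self: "e \<in> I \<Longrightarrow> normal_inverse B e e"
  by (auto simp: normal_inverse_def I_D mult_B)

lemma I_N: "e \<in> I \<Longrightarrow> e \<in> N"
  using normal_inverse_self normal_inverse_N by blast

lemma dagger_of_I: "e \<in> I \<Longrightarrow> e\<^sup>\<dagger> = e"
  using normal_inverse_self dagger_eqI by blast

lemma dagger_zero: "0\<^sup>\<dagger> = 0"
  using dagger_of_I zero_I by blast

lemma dagger_conj_I: assumes "n \<in> N" "e \<in> I" shows "n\<^sup>\<dagger> * e * n \<in> I" "n * e * n\<^sup>\<dagger> \<in> I"
proof -
  have "(e * n)\<^sup>\<dagger> * (e * n) = n\<^sup>\<dagger> * e * n"
    using assms by (simp add: dagger_mult I_N dagger_of_I mult.assoc I_idem_left)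
  then show "n\<^sup>\<dagger> * e * n \<in> I" using dagger_I(1)[of "e * n"] assms by (simp add: mult_N I_N)
  have "(n * e) * (n * e)\<^sup>\<dagger> = n * e * n\<^sup>\<dagger>"
    using assms by (simp add: dagger_mult I_N dagger_of_I mult.assoc I_idem_left)
  then show "n * e * n\<^sup>\<dagger> \<in> I" using dagger_I(2)[of "n * e"] assms by (simp add: mult_N I_N)
qed

text \<open>
  Idempotents can be moved past a normaliser at the price of conjugating them. This makes the order
  symmetric: being below \<open>m\<close> means being \<open>e * m\<close>, and equally being \<open>m * f\<close>, for an idempotent.
\<close>

lemma left_I_eq_right_I: assumes "n \<in> N" "e \<in> I" shows "e * n = n * (n\<^sup>\<dagger> * e * n)"
proof -
  have "n * (n\<^sup>\<dagger> * e * n) = (n * n\<^sup>\<dagger>) * e * n" by (simp add: mult.assoc)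
  also have "\<dots> = e * (n * n\<^sup>\<dagger> * n)" using assms I_commute[OF dagger_I(2)] by (simp add: mult.assoc)
  finally show ?thesis using assms dagger_mult_cancel by simp
qed

lemma right_I_eq_left_I: assumes "n \<in> N" "e \<in> I" shows "n * e = (n * e * n\<^sup>\<dagger>) * n"
proof -
  have "(n * e * n\<^sup>\<dagger>) * n = n * (e * (n\<^sup>\<dagger> * n))" by (simp add: mult.assoc)
  also have "\<dots> = (n * (n\<^sup>\<dagger> * n)) * e" using assms I_commute[OF dagger_I(1)] by (simp add: mult.assoc)
  finally show ?thesis using assms dagger_mult_cancel by simp
qed

lemma nle_right_D: assumes "n \<in> N" "m \<in> N" "nle B n m" shows "n = m * (n\<^sup>\<dagger> * n)"
proof -
  define e where "e = n * n\<^sup>\<dagger>"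
  have e: "e \<in> I" "n = e * m" using assms dagger_I unfolding e_def nle_def by auto
  have "n\<^sup>\<dagger> * n = m\<^sup>\<dagger> * e * m"
    using e assms by (simp add: dagger_mult I_N dagger_of_I mult.assoc I_idem_left)
  then show ?thesis using left_I_eq_right_I[OF assms(2) e(1)] e(2) by simp
qed

lemma nle_leftI: assumes "m \<in> N" "e \<in> I" shows "nle B (e * m) m"
proof -
  have "e * m * (e * m)\<^sup>\<dagger> * m = (e * (m * m\<^sup>\<dagger>)) * e * m"
    using assms by (simp add: dagger_mult I_N dagger_of_I mult.assoc)
  also have "\<dots> = e * e * (m * m\<^sup>\<dagger>) * m"
    using assms by (simp add: I_right_commute dagger_I)
  also have "\<dots> = e * m" using assms by (metis I_D(2) dagger_mult_cancel(2) mult.assoc)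
  finally show ?thesis by (simp add: nle_def)
qed

lemma nle_rightI: assumes "m \<in> N" "e \<in> I" shows "nle B (m * e) m"
  using nle_leftI[OF assms(1) dagger_conj_I(2)[OF assms]] right_I_eq_left_I[OF assms] by simp

lemma nle_iff_left: assumes "n \<in> N" "m \<in> N" shows "nle B n m \<longleftrightarrow> (\<exists>e\<in>I. n = e * m)"
proof
  assume "nle B n m"
  then show "\<exists>e\<in>I. n = e * m" using dagger_I(2)[OF assms(1)] unfolding nle_def by blast
qed (use nle_leftI assms in blast)

lemma nle_refl: "n \<in> N \<Longrightarrow> nle B n n"
  by (simp add: nle_def dagger_mult_cancel)

lemma nle_trans: assumes "n \<in> N" "m \<in> N" "p \<in> N" "nle B n m" "nle B m p" shows "nle B n p"
proof -
  obtain e f where "e \<in> I" "f \<in> I" "n = e * m" "m = f * p" using assms nle_iff_left by blast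
  then have "e * f \<in> I" "n = e * f * p" by (simp_all add: mult_I mult.assoc)
  then show ?thesis using nle_leftI[OF assms(3)] by blast
qed

lemma nle_mult_right_cong:
  assumes "n \<in> N" "m \<in> N" "nle B n m" "m * a = m * b" shows "n * a = n * b"
proof -
  obtain e where "n = e * m" using assms nle_iff_left by blast
  then show ?thesis using assms(4) by (simp add: mult.assoc)
qed

lemma nle_fixed_right: assumes "n \<in> N" "m \<in> N" "nle B n m" "m * a = m" shows "n * a = n"
proof -
  obtain e where "n = e * m" using assms nle_iff_left by blast
  then show ?thesis using assms(4) by (simp add: mult.assoc)
qed

lemma nle_mult_right: assumes "n \<in> N" "m \<in> N" "f \<in> N" "nle B n m" shows "nle B (n * f) (m * f)"
proof -
  obtain e where e: "e \<in> I" "n = e * m" using assms nle_iff_left by blast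
  then have "n * f = e * (m * f)" by (simp add: mult.assoc)
  then show ?thesis using e(1) nle_leftI[of "m * f" e] assms mult_N by simp
qed

lemma nle_zero: "nle B n 0 \<Longrightarrow> n = 0"
  by (simp add: nle_def)

lemma nle_dagger: assumes "n \<in> N" "m \<in> N" "nle B n m" shows "nle B (n\<^sup>\<dagger>) (m\<^sup>\<dagger>)"
proof -
  obtain e where e: "e \<in> I" "n = e * m" using assms nle_iff_left by blast
  then have "n\<^sup>\<dagger> = m\<^sup>\<dagger> * e" using assms by (simp add: dagger_mult I_N dagger_of_I)
  then show ?thesis using e assms nle_rightI dagger_N by simp
qed

lemma filterD:
  assumes "nfilter B U"
  shows "U \<subseteq> N" "0 \<notin> U" "m \<in> U \<Longrightarrow> n \<in> U \<Longrightarrow> \<exists>p\<in>U. nle B p m \<and> nle B p n"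
    "n \<in> U \<Longrightarrow> m \<in> N \<Longrightarrow> nle B n m \<Longrightarrow> m \<in> U"
  using assms unfolding nfilter_def up_def by blast+

lemma filterI:
  assumes "U \<subseteq> N" "0 \<notin> U" "\<And>m n. m \<in> U \<Longrightarrow> n \<in> U \<Longrightarrow> \<exists>p\<in>U. nle B p m \<and> nle B p n"
    "\<And>m n. n \<in> U \<Longrightarrow> m \<in> N \<Longrightarrow> nle B n m \<Longrightarrow> m \<in> U"
  shows "nfilter B U"
  using assms nle_refl unfolding nfilter_def up_def by blast

lemma UF_filter: "U \<in> UF \<Longrightarrow> nfilter B U" by (simp add: ultrafilters_def)
lemma UF_nonempty: "U \<in> UF \<Longrightarrow> U \<noteq> {}" by (simp add: ultrafilters_def)
lemma UF_maximal: "U \<in> UF \<Longrightarrow> nfilter B V \<Longrightarrow> U \<subseteq> V \<Longrightarrow> V = U"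
  by (simp add: ultrafilters_def)
lemma UFI: assumes "nfilter B U" "U \<noteq> {}" "\<And>V. nfilter B V \<Longrightarrow> U \<subseteq> V \<Longrightarrow> V \<subseteq> U"
  shows "U \<in> UF"
  unfolding ultrafilters_def using assms by blast

lemma UF_N: "U \<in> UF \<Longrightarrow> n \<in> U \<Longrightarrow> n \<in> N" using UF_filter filterD(1) by blast
lemma UF_nonzero: "U \<in> UF \<Longrightarrow> 0 \<notin> U" using UF_filter filterD(2) by blast
lemma UF_up: "U \<in> UF \<Longrightarrow> n \<in> U \<Longrightarrow> m \<in> N \<Longrightarrow> nle B n m \<Longrightarrow> m \<in> U"
  using UF_filter filterD(4) by blast
lemma UF_directed: "U \<in> UF \<Longrightarrow> m \<in> U \<Longrightarrow> n \<in> U \<Longrightarrow> \<exists>p\<in>U. nle B p m \<and> nle B p n"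
  using UF_filter filterD(3) by blast

section \<open>Ultrafilters as germs\<close>

text \<open>
  An ultrafilter of the generalised Boolean algebra of idempotents, where \<open>e * f = e\<close> says that \<open>e\<close> is
  below \<open>f\<close>. As there need not be a top element, the prime property is relative: an element \<open>e\<close> of the
  filter decides every \<open>f\<close> through \<open>e * f\<close> and its complement \<open>e - e * f\<close>.
\<close>

definition point :: "'a set \<Rightarrow> bool" where
  "point x \<longleftrightarrow> x \<subseteq> I \<and> x \<noteq> {} \<and> 0 \<notin> x \<and> (\<forall>e\<in>x. \<forall>f\<in>x. e * f \<in> x) \<and>
     (\<forall>e\<in>x. \<forall>f\<in>I. e * f = e \<longrightarrow> f \<in> x) \<and> (\<forall>e\<in>x. \<forall>f\<in>I. e * f \<in> x \<or> e - e * f \<in> x)"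

lemma pointD: assumes "point x"
  shows "e \<in> x \<Longrightarrow> e \<in> I" "\<exists>e. e \<in> x" "e \<in> x \<Longrightarrow> e \<noteq> 0" "e \<in> x \<Longrightarrow> f \<in> x \<Longrightarrow> e * f \<in> x"
    "e \<in> x \<Longrightarrow> f \<in> I \<Longrightarrow> e * f = e \<Longrightarrow> f \<in> x"
    "e \<in> x \<Longrightarrow> f \<in> I \<Longrightarrow> e * f \<in> x \<or> e - e * f \<in> x"
  using assms unfolding point_def by blast+

lemma point_mult_D: assumes "point x" "e * f \<in> x" "e \<in> I" "f \<in> I" shows "e \<in> x" "f \<in> x"
proof -
  have "e * f * f = e * f" "e * f * e = e * f"
    using assms(3,4) by (simp_all add: I_idem_right I_right_commute I_D)
  then show "e \<in> x" "f \<in> x" using pointD(5)[OF assms(1,2)] assms(3,4) by auto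
qed

lemma point_maximal: assumes "point x" "point y" "x \<subseteq> y" shows "x = y"
proof -
  have "f \<in> x" if f: "f \<in> y" for f
  proof -
    obtain e where e: "e \<in> x" using pointD(2)[OF assms(1)] by blast
    have fI: "f \<in> I" "e \<in> I" using f e assms pointD(1) by blast+
    have "e - e * f \<notin> x"
      using diff_I_annihilates[OF fI(2,1)] pointD(3,4)[OF assms(2)] f assms(3) by blast
    then show "f \<in> x" using pointD(6)[OF assms(1) e fI(1)] point_mult_D[OF assms(1)] fI by blast
  qed
  then show ?thesis using assms by blast
qed

text \<open>
  The normalisers with the same germ as \<open>n\<close> at the point \<open>x\<close>.
\<close>

definition germ :: "'a \<Rightarrow> 'a set \<Rightarrow> 'a set" where
  "germ n x = {m \<in> N. \<exists>f\<in>x. m * f = n * f}"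

text \<open>
  The source and range points of an ultrafilter. The condition \<open>m * e = m\<close> is the same as \<open>m\<^sup>\<dagger> * m\<close> being
  below \<open>e\<close>, and similarly for the range; in this form the dagger is avoided.
\<close>

definition sp :: "'a set \<Rightarrow> 'a set" where "sp U = {e \<in> I. \<exists>m\<in>U. m * e = m}"
definition rp :: "'a set \<Rightarrow> 'a set" where "rp U = {e \<in> I. \<exists>m\<in>U. e * m = m}"

lemma UF_dagger_mem_sp: assumes "U \<in> UF" "n \<in> U" shows "n\<^sup>\<dagger> * n \<in> sp U"
proof -
  have "n \<in> N" using assms UF_N by blast
  then have "n\<^sup>\<dagger> * n \<in> I" "n * (n\<^sup>\<dagger> * n) = n" by (rule dagger_I dagger_mult_cancel)+
  then show ?thesis using assms(2) unfolding sp_def by blast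
qed

lemma germ_mult_right: assumes "n \<in> N" "f \<in> I" "f \<in> x" shows "n * f \<in> germ n x"
proof -
  have "n * f \<in> N" "n * f * f = n * f" using assms by (simp_all add: mult_N I_N I_idem_right)
  then show ?thesis using assms(3) unfolding germ_def by blast
qed

text \<open>
  Multiplying all members by \<open>f\<close> generates a filter that contains \<open>U\<close>, so maximality applies. Together
  with the reduction in \<open>point_sp\<close> this is where ultrafilters become prime.
\<close>

lemma UF_mult_right:
  assumes U: "U \<in> UF" and f: "f \<in> I" and nz: "\<And>u. u \<in> U \<Longrightarrow> u * f \<noteq> 0" and u: "u \<in> U"
  shows "u * f \<in> U"
proof -
  let ?V = "{m \<in> N. \<exists>u\<in>U. nle B (u * f) m}"
  have uN: "u * f \<in> N" if "u \<in> U" for u using that U f by (simp add: UF_N mult_N I_N)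
  have "nfilter B ?V"
  proof (rule filterI)
    show "0 \<notin> ?V" using nz nle_zero by blast
  next
    fix m n assume "m \<in> ?V" "n \<in> ?V"
    then obtain u v where uv: "u \<in> U" "v \<in> U" "nle B (u * f) m" "nle B (v * f) n" "m \<in> N" "n \<in> N"
      by blast
    then obtain p where p: "p \<in> U" "nle B p u" "nle B p v" using UF_directed[OF U] by blast
    have "nle B (p * f) k" if "nle B p w" "w \<in> U" "nle B (w * f) k" "k \<in> N" for w k
    proof -
      have "nle B (p * f) (w * f)"
        using nle_mult_right that(1) UF_N[OF U p(1)] UF_N[OF U that(2)] I_N[OF f] by blast
      then show ?thesis using nle_trans[OF uN[OF p(1)] uN[OF that(2)] that(4)] that(3) by blast
    qed
    then have "nle B (p * f) m" "nle B (p * f) n" using p uv by blast+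
    then show "\<exists>p\<in>?V. nle B p m \<and> nle B p n" using uN p(1) nle_refl by blast
  next
    fix m n assume "n \<in> ?V" "m \<in> N" "nle B n m"
    then show "m \<in> ?V" using uN nle_trans by blast
  qed auto
  moreover have "U \<subseteq> ?V" using U f nle_rightI UF_N by blast
  ultimately have "?V = U" using UF_maximal[OF U] by blast
  then show ?thesis using u uN nle_refl by blast
qed

text \<open>
  Given \<open>e\<close> in the source point and any idempotent \<open>f\<close>, either no member of \<open>U\<close> is annihilated by \<open>f\<close>, and
  then multiplication by \<open>f\<close> stays in \<open>U\<close>, or some member is, and then a smaller one is fixed by the
  complement \<open>e - e * f\<close>.
\<close>

lemma point_sp: assumes U: "U \<in> UF" shows "point (sp U)"
proof -
  have below: "p * e = p" if "p \<in> U" "m \<in> U" "nle B p m" "m * e = m" for p m e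
    using that UF_N[OF U] nle_fixed_right by blast
  have "sp U \<noteq> {}"
  proof -
    obtain m where "m \<in> U" using UF_nonempty[OF U] by blast
    then have "m\<^sup>\<dagger> * m \<in> sp U" using U UF_dagger_mem_sp by blast
    then show ?thesis by blast
  qed
  moreover have "0 \<notin> sp U" using UF_nonzero[OF U] by (auto simp: sp_def)
  moreover have "e * f \<in> sp U" if ef: "e \<in> sp U" "f \<in> sp U" for e f
  proof -
    obtain m n where "m \<in> U" "n \<in> U" "m * e = m" "n * f = n" "e \<in> I" "f \<in> I"
      using ef by (auto simp: sp_def)
    moreover from this obtain p where "p \<in> U" "nle B p m" "nle B p n" using UF_directed[OF U] by blast
    ultimately have "p \<in> U" "p * e = p" "p * f = p" "e * f \<in> I" using below mult_I by blast+
    then have "p * (e * f) = p" by (simp flip: mult.assoc)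
    then show ?thesis using \<open>p \<in> U\<close> \<open>e * f \<in> I\<close> unfolding sp_def by blast
  qed
  moreover have "f \<in> sp U" if ef: "e \<in> sp U" "f \<in> I" "e * f = e" for e f
  proof -
    obtain m where m: "m \<in> U" "m * e = m" using ef(1) by (auto simp: sp_def)
    then have "m * f = m * (e * f)" by (simp flip: mult.assoc)
    then show ?thesis using m ef unfolding sp_def by auto
  qed
  moreover have "e * f \<in> sp U \<or> e - e * f \<in> sp U" if ef: "e \<in> sp U" "f \<in> I" for e f
  proof -
    obtain m where m: "m \<in> U" "m * e = m" "e \<in> I" using ef by (auto simp: sp_def)
    show ?thesis
    proof (cases "\<forall>u\<in>U. u * f \<noteq> 0")
      case True
      then have "m * f \<in> U" using UF_mult_right[OF U ef(2) _ m(1)] by blast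
      moreover have "m * f * (e * f) = m * f"
        using m(2,3) ef(2) by (simp add: I_right_commute I_idem_right flip: mult.assoc)
      ultimately show ?thesis using m ef unfolding sp_def by (auto simp: mult_I)
    next
      case False
      then obtain u where u: "u \<in> U" "u * f = 0" by blast
      obtain p where p: "p \<in> U" "nle B p u" "nle B p m" using UF_directed[OF U u(1) m(1)] by blast
      have "p * f = 0" using u p nle_mult_right_cong[OF UF_N[OF U] UF_N[OF U], of p u f 0] by simp
      moreover have "p * e = p" using below p m by blast
      ultimately have "p * (e - e * f) = p" by (simp add: algebra_simps flip: mult.assoc)
      then show ?thesis using p m ef diff_I unfolding sp_def by blast
    qed
  qed
  ultimately show ?thesis unfolding point_def by (auto simp: sp_def)
qed

lemma UF_eq_germ: assumes U: "U \<in> UF" and n: "n \<in> U" shows "U = germ n (sp U)"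
proof (intro equalityI subsetI)
  fix m assume m: "m \<in> U"
  obtain p where p: "p \<in> U" "nle B p m" "nle B p n" using UF_directed[OF U m n] by blast
  have N: "p \<in> N" "m \<in> N" "n \<in> N" using U p m n UF_N by blast+
  have "p\<^sup>\<dagger> * p \<in> sp U" using U p(1) UF_dagger_mem_sp by blast
  moreover have "m * (p\<^sup>\<dagger> * p) = n * (p\<^sup>\<dagger> * p)" using nle_right_D N p by metis
  ultimately show "m \<in> germ n (sp U)" using N unfolding germ_def by blast
next
  fix m assume "m \<in> germ n (sp U)"
  then obtain f u where f: "m \<in> N" "f \<in> I" "u \<in> U" "u * f = u" "m * f = n * f"
    unfolding germ_def sp_def by blast
  obtain p where p: "p \<in> U" "nle B p u" "nle B p n" using UF_directed[OF U f(3) n] by blast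
  have N: "p \<in> N" "u \<in> N" "n \<in> N" using U p f n UF_N by blast+
  have pf: "p * f = p" using f(4) p(2) N nle_fixed_right by blast
  have "p = n * (p\<^sup>\<dagger> * p)" using nle_right_D N p by blast
  then have "p = n * (p\<^sup>\<dagger> * p) * f" using pf by simp
  also have "\<dots> = m * f * (p\<^sup>\<dagger> * p)" using f N by (simp add: I_right_commute dagger_I)
  finally have "p = m * (f * (p\<^sup>\<dagger> * p))" by (simp add: mult.assoc)
  then have "nle B p m" using nle_rightI f N dagger_I mult_I by metis
  then show "m \<in> U" using UF_up[OF U p(1)] f by blast
qed

text \<open>
  If \<open>m * f = n * f\<close>, then \<open>m\<^sup>\<dagger> * m\<close> and \<open>n\<^sup>\<dagger> * n\<close> agree below \<open>f\<close>.
\<close>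

lemma germ_dagger_cong:
  assumes x: "point x" and n: "n \<in> N" "n\<^sup>\<dagger> * n \<in> x" and m: "m \<in> germ n x"
  shows "m\<^sup>\<dagger> * m \<in> x"
proof -
  obtain f where f: "f \<in> x" "m * f = n * f" "m \<in> N" using m by (auto simp: germ_def)
  have fI: "f \<in> I" using f x pointD by blast
  have *: "(k * f)\<^sup>\<dagger> * (k * f) = k\<^sup>\<dagger> * k * f" if "k \<in> N" for k
  proof -
    have "(k * f)\<^sup>\<dagger> * (k * f) = f * (k\<^sup>\<dagger> * k) * f"
      using that fI by (simp add: I_N dagger_mult dagger_of_I mult.assoc)
    also have "\<dots> = k\<^sup>\<dagger> * k * f"
      using I_commute[OF fI dagger_I(1)[OF that]] I_idem_right[OF fI] by simp
    finally show ?thesis .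
  qed
  have "n\<^sup>\<dagger> * n * f \<in> x" using pointD(4)[OF x n(2) f(1)] .
  then have "m\<^sup>\<dagger> * m * f \<in> x" using * n(1) f(2,3) by metis
  then show ?thesis using point_mult_D[OF x] fI f(3) dagger_I by blast
qed

text \<open>
  For maximality, let \<open>v\<close> be in a larger filter and \<open>p\<close> below both \<open>v\<close> and \<open>n\<close> in it. If \<open>p\<^sup>\<dagger> * p\<close> were not in
  \<open>x\<close>, its complement in \<open>n\<^sup>\<dagger> * n\<close> would be, giving a member of the germ orthogonal to \<open>p\<close>; so it is in
  \<open>x\<close>, and \<open>v\<close> and \<open>n\<close> agree on it.
\<close>

lemma germ_UF:
  assumes x: "point x" and n: "n \<in> N" "n\<^sup>\<dagger> * n \<in> x"
  shows "germ n x \<in> UF" "n \<in> germ n x" "sp (germ n x) = x"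
proof -
  have xI: "f \<in> I" if "f \<in> x" for f using that x pointD by blast
  have nf: "n * f \<in> germ n x" if "f \<in> x" for f
    using that xI[OF that] n(1) germ_mult_right by blast
  have nz: "n * f \<noteq> 0" if "f \<in> x" for f
  proof
    assume "n * f = 0"
    then have "n\<^sup>\<dagger> * n * f = 0" by (simp add: mult.assoc)
    then show False using pointD(4)[OF x n(2) that] pointD(3)[OF x] by blast
  qed
  have filt: "nfilter B (germ n x)"
  proof (rule filterI)
    show "germ n x \<subseteq> N" by (auto simp: germ_def)
    show "0 \<notin> germ n x" using nz by (auto simp: germ_def dest: sym)
  next
    fix m k assume "m \<in> germ n x" "k \<in> germ n x"
    then obtain f g where fg: "f \<in> x" "g \<in> x" "m * f = n * f" "k * g = n * g" "m \<in> N" "k \<in> N"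
      by (auto simp: germ_def)
    have "n * (f * g) = m * (f * g)" using fg(3) by (simp flip: mult.assoc)
    moreover have "n * (f * g) = k * (f * g)"
      using fg xI by (simp add: I_right_commute[of f g] flip: mult.assoc)
    ultimately show "\<exists>p\<in>germ n x. nle B p m \<and> nle B p k"
      using nf[OF pointD(4)[OF x fg(1,2)]] nle_rightI fg xI mult_I by metis
  next
    fix m k assume m: "m \<in> germ n x" and k: "k \<in> N" "nle B m k"
    then obtain f where f: "f \<in> x" "m * f = n * f" "m \<in> N" by (auto simp: germ_def)
    have g: "m\<^sup>\<dagger> * m \<in> x" using germ_dagger_cong[OF x n m] .
    have "k * ((m\<^sup>\<dagger> * m) * f) = m * f" using nle_right_D[OF f(3) k] by (simp flip: mult.assoc)
    also have "\<dots> = m * f * (m\<^sup>\<dagger> * m)"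
      using I_right_commute[OF xI[OF f(1)] xI[OF g], of m] dagger_mult_cancel(3)[OF f(3)] by simp
    also have "\<dots> = n * ((m\<^sup>\<dagger> * m) * f)"
      using f I_right_commute[OF xI[OF f(1)] xI[OF g], of n] by (simp add: mult.assoc)
    finally show "k \<in> germ n x" using pointD(4)[OF x g f(1)] k(1) unfolding germ_def by blast
  qed
  show nin: "n \<in> germ n x" using n pointD(2)[OF x] by (auto simp: germ_def)
  show "germ n x \<in> UF"
  proof (rule UFI[OF filt])
    show "germ n x \<noteq> {}" using nin by blast
    fix V assume V: "nfilter B V" "germ n x \<subseteq> V"
    show "V \<subseteq> germ n x"
    proof
      fix v assume v: "v \<in> V"
      then obtain p where p: "p \<in> V" "nle B p v" "nle B p n" using filterD(3)[OF V(1)] V(2) nin by blast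
      have N: "p \<in> N" "v \<in> N" using p v filterD(1)[OF V(1)] by auto
      define e where "e = n\<^sup>\<dagger> * n"
      define g where "g = p\<^sup>\<dagger> * p"
      have I: "e \<in> I" "g \<in> I" unfolding e_def g_def using n N dagger_I by auto
      have ex: "e \<in> x" using n(2) e_def by simp
      have "e - e * g \<notin> x"
      proof
        assume h: "e - e * g \<in> x"
        then have "n * (e - e * g) \<in> V" using nf V(2) by blast
        then obtain q where q: "q \<in> V" "nle B q p" "nle B q (n * (e - e * g))"
          using filterD(3)[OF V(1)] p(1) by blast
        have qN: "q \<in> N" "n * (e - e * g) \<in> N" using q(1) filterD(1)[OF V(1)] n nf[OF h] by (auto simp: germ_def)
        have "q * g = q" using nle_fixed_right[OF qN(1) N(1) q(2)] dagger_mult_cancel(3)[OF N(1)] g_def by simp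
        moreover have "q * (e - e * g) = q"
          using nle_fixed_right[OF qN q(3)] I_idem_right[OF diff_I[OF I]] by blast
        ultimately have "q = q * (e - e * g) * g" by simp
        then have "q = 0" using diff_I_annihilates[OF I] by (simp add: mult.assoc)
        then show False using q(1) filterD(2)[OF V(1)] by blast
      qed
      then have "g \<in> x" using pointD(6)[OF x ex I(2)] point_mult_D[OF x] I by blast
      moreover have "v * g = n * g" unfolding g_def using nle_right_D[OF N(1)] N(2) n(1) p by metis
      ultimately show "v \<in> germ n x" using N unfolding germ_def by blast
    qed
  qed
  show "sp (germ n x) = x"
  proof (intro equalityI subsetI)
    fix e assume "e \<in> sp (germ n x)"
    then obtain m where m: "m \<in> germ n x" "m * e = m" "e \<in> I" by (auto simp: sp_def)
    have "m\<^sup>\<dagger> * m * e = m\<^sup>\<dagger> * m" using m by (simp add: mult.assoc)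
    then show "e \<in> x" using pointD(5)[OF x germ_dagger_cong[OF x n m(1)]] m(3) by blast
  next
    fix e assume "e \<in> x"
    then have "e \<in> I" "n * e \<in> germ n x" "n * e * e = n * e" using nf xI I_idem_right by blast+
    then show "e \<in> sp (germ n x)" unfolding sp_def by blast
  qed
qed

lemma dagger_mem_point:
  assumes x: "point x" and n: "n \<in> N" and nz: "\<And>f. f \<in> x \<Longrightarrow> n * f \<noteq> 0"
  shows "n\<^sup>\<dagger> * n \<in> x"
proof -
  obtain e where e: "e \<in> x" using pointD(2)[OF x] by blast
  have I: "e \<in> I" "n\<^sup>\<dagger> * n \<in> I" using e pointD(1)[OF x] n dagger_I by blast+
  have "n * (e - e * (n\<^sup>\<dagger> * n)) = 0"
  proof -
    have "n * (e - e * (n\<^sup>\<dagger> * n)) = n * (n\<^sup>\<dagger> * n) * (e - e * (n\<^sup>\<dagger> * n))"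
      using dagger_mult_cancel(3)[OF n] by simp
    then show ?thesis using diff_I_annihilates(2)[OF I] by (simp add: mult.assoc)
  qed
  then show ?thesis using nz pointD(6)[OF x e I(2)] point_mult_D[OF x] I by blast
qed

lemma UF_eqI:
  assumes "U \<in> UF" "V \<in> UF" "sp U = sp V" "n \<in> U" "n \<in> V" shows "U = V"
  using assms UF_eq_germ by metis

lemma sp_mult_mem: assumes "U \<in> UF" "n \<in> U" "e \<in> sp U" shows "n * e \<in> U"
proof -
  have "e \<in> I" using assms by (simp add: sp_def)
  then have "n * e \<in> germ n (sp U)" using assms UF_N germ_mult_right by blast
  then show ?thesis using UF_eq_germ[OF assms(1,2)] by simp
qed

lemma UF_common: assumes "U \<in> UF" "m \<in> U" "n \<in> U" shows "\<exists>f\<in>sp U. m * f = n * f"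
proof -
  have "m \<in> germ n (sp U)" using UF_eq_germ assms by metis
  then show ?thesis by (auto simp: germ_def)
qed

text \<open>
  Order automorphisms of the inverse semigroup that fix \<open>0\<close> permute the ultrafilters. This covers the
  inversion as well as the action of the scalar units.
\<close>

lemma UF_image:
  assumes f: "\<And>n. n \<in> N \<Longrightarrow> f n \<in> N" "\<And>n. n \<in> N \<Longrightarrow> g n \<in> N"
    and inv: "\<And>n. n \<in> N \<Longrightarrow> g (f n) = n" "\<And>n. n \<in> N \<Longrightarrow> f (g n) = n"
    and mono: "\<And>m n. m \<in> N \<Longrightarrow> n \<in> N \<Longrightarrow> nle B m n \<Longrightarrow> nle B (f m) (f n)"
      "\<And>m n. m \<in> N \<Longrightarrow> n \<in> N \<Longrightarrow> nle B m n \<Longrightarrow> nle B (g m) (g n)"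
    and zero: "f 0 = 0" and U: "U \<in> UF"
  shows "f ` U \<in> UF"
proof -
  have zN: "0 \<in> N" using I_N zero_I by blast
  have g0: "g 0 = 0" using zero inv(1)[OF zN] by simp
  have filt: "nfilter B (h ` V)" if V: "nfilter B V"
    and h: "\<And>n. n \<in> N \<Longrightarrow> h n \<in> N" "\<And>n. n \<in> N \<Longrightarrow> k n \<in> N" "\<And>n. n \<in> N \<Longrightarrow> k (h n) = n"
      "\<And>n. n \<in> N \<Longrightarrow> h (k n) = n" "k 0 = 0"
      "\<And>m n. m \<in> N \<Longrightarrow> n \<in> N \<Longrightarrow> nle B m n \<Longrightarrow> nle B (h m) (h n)"
      "\<And>m n. m \<in> N \<Longrightarrow> n \<in> N \<Longrightarrow> nle B m n \<Longrightarrow> nle B (k m) (k n)" for h k V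
  proof (rule filterI)
    note VN = filterD(1)[OF V]
    show "h ` V \<subseteq> N" using VN h by blast
    show "0 \<notin> h ` V"
    proof
      assume "0 \<in> h ` V"
      then obtain v where "v \<in> V" "h v = 0" by force
      then have "v = 0" using VN h(3,5) by (metis subsetD)
      then show False using \<open>v \<in> V\<close> filterD(2)[OF V] by blast
    qed
  next
    note VN = filterD(1)[OF V]
    fix m n assume "m \<in> h ` V" "n \<in> h ` V"
    then show "\<exists>p\<in>h ` V. nle B p m \<and> nle B p n"
      using filterD(3)[OF V] VN h(6) by (smt (verit) image_iff subsetD)
  next
    note VN = filterD(1)[OF V]
    fix m n assume "n \<in> h ` V" "m \<in> N" "nle B n m"
    then obtain v where v: "v \<in> V" "n = h v" by blast
    have "nle B (k n) (k m)" using v VN h \<open>m \<in> N\<close> \<open>nle B n m\<close> by blast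
    then have "k m \<in> V" using v VN h filterD(4)[OF V v(1)] \<open>m \<in> N\<close> by (metis subsetD)
    then show "m \<in> h ` V" using h(4)[OF \<open>m \<in> N\<close>] by force
  qed
  show ?thesis
  proof (rule UFI)
    show "nfilter B (f ` U)" by (rule filt[where k = g]) (use U UF_filter f inv mono g0 in auto)
    show "f ` U \<noteq> {}" using UF_nonempty[OF U] by blast
    fix V assume V: "nfilter B V" "f ` U \<subseteq> V"
    have "nfilter B (g ` V)" by (rule filt[where k = f]) (use V f inv mono zero in auto)
    moreover have "U \<subseteq> g ` V"
    proof
      fix u assume "u \<in> U"
      then have "f u \<in> V" "g (f u) = u" using V inv UF_N[OF U] by auto
      then show "u \<in> g ` V" by force
    qed
    ultimately have "g ` V = U" using UF_maximal[OF U] by blast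
    then show "V \<subseteq> f ` U" using inv(2) filterD(1)[OF V(1)] by force
  qed
qed

section \<open>The groupoid of ultrafilters\<close>

abbreviation S :: "'a set topgroupoid_struct" where "S \<equiv> Sigma_groupoid B"
abbreviation Uinv :: "'a set \<Rightarrow> 'a set" where "Uinv U \<equiv> dagger B ` U"
definition Umult :: "'a set \<Rightarrow> 'a set \<Rightarrow> 'a set" where
  "Umult U V = up B {m * n | m n. m \<in> U \<and> n \<in> V}"

lemma S_sel: "arrows S = UF" "gmult S = Umult" "ginv S = Uinv"
  by (auto simp: Sigma_groupoid_def Umult_def fun_eq_iff)

lemma Uinv_UF: "U \<in> UF \<Longrightarrow> Uinv U \<in> UF"
  by (rule UF_image[of "dagger B" "dagger B"]) (auto simp: dagger_N dagger_dagger nle_dagger dagger_zero)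

lemma Uinv_Uinv: assumes "U \<in> UF" shows "Uinv (Uinv U) = U"
  using assms by (auto simp: image_image UF_N dagger_dagger)

lemma Uinv_mem: assumes "U \<in> UF" "n \<in> N" shows "n\<^sup>\<dagger> \<in> Uinv U \<longleftrightarrow> n \<in> U"
proof
  assume "n\<^sup>\<dagger> \<in> Uinv U"
  then obtain u where u: "u \<in> U" "n\<^sup>\<dagger> = u\<^sup>\<dagger>" by blast
  then have "n\<^sup>\<dagger>\<^sup>\<dagger> = u\<^sup>\<dagger>\<^sup>\<dagger>" by simp
  then have "n = u" using u(1) UF_N[OF assms(1)] assms(2) by (simp add: dagger_dagger)
  then show "n \<in> U" using u(1) by simp
qed (rule imageI)

lemma sp_Uinv: assumes "U \<in> UF" shows "sp (Uinv U) = rp U"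
proof -
  have "m\<^sup>\<dagger> * e = m\<^sup>\<dagger> \<longleftrightarrow> e * m = m" if "m \<in> U" "e \<in> I" for m e
  proof -
    have "(e * m)\<^sup>\<dagger> = m\<^sup>\<dagger> * e" "e * m \<in> N" "m \<in> N"
      using that UF_N[OF assms] by (auto simp: dagger_mult I_N dagger_of_I mult_N)
    then show ?thesis by (metis dagger_dagger)
  qed
  then show ?thesis by (auto simp: sp_def rp_def)
qed

lemma rp_Uinv: "U \<in> UF \<Longrightarrow> rp (Uinv U) = sp U"
  by (metis sp_Uinv Uinv_UF Uinv_Uinv)

lemma point_rp: "U \<in> UF \<Longrightarrow> point (rp U)"
  by (metis sp_Uinv Uinv_UF point_sp)

lemma UF_dagger_mem_rp: assumes "U \<in> UF" "n \<in> U" shows "n * n\<^sup>\<dagger> \<in> rp U"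
proof -
  have "n \<in> N" using assms UF_N by blast
  then have "n * n\<^sup>\<dagger> \<in> I" "n * n\<^sup>\<dagger> * n = n" by (rule dagger_I dagger_mult_cancel)+
  then show ?thesis using assms(2) unfolding rp_def by blast
qed

text \<open>
  If the points differ, idempotents \<open>e\<close> and \<open>f - f * e\<close> in them are orthogonal and produce a zero product;
  if they agree, \<open>m\<^sup>\<dagger> * m\<close> and \<open>n * n\<^sup>\<dagger>\<close> lie in a common point and cannot be orthogonal.
\<close>

lemma composable_iff: "(U, V) \<in> composables S \<longleftrightarrow> U \<in> UF \<and> V \<in> UF \<and> sp U = rp V"
proof -
  have "(\<forall>m\<in>U. \<forall>n\<in>V. m * n \<noteq> 0) \<longleftrightarrow> sp U = rp V" if U: "U \<in> UF" and V: "V \<in> UF"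
  proof
    assume nz: "\<forall>m\<in>U. \<forall>n\<in>V. m * n \<noteq> 0"
    have "sp U \<subseteq> rp V"
    proof
      fix e assume e: "e \<in> sp U"
      then obtain m where m: "e \<in> I" "m \<in> U" "m * e = m" by (auto simp: sp_def)
      obtain f where f: "f \<in> rp V" "f \<in> I" using pointD[OF point_rp[OF V]] by blast
      have "f - f * e \<notin> rp V"
      proof
        assume "f - f * e \<in> rp V"
        then obtain n where n: "n \<in> V" "(f - f * e) * n = n" by (auto simp: rp_def)
        have "m * n = (m * e) * ((f - f * e) * n)" using m n by simp
        also have "\<dots> = m * (e * (f - f * e)) * n" by (simp add: mult.assoc)
        also have "\<dots> = 0" using diff_I_annihilates f m by simp
        finally show False using nz m n by blast
      qed
      then show "e \<in> rp V" using pointD(6)[OF point_rp[OF V] f(1) m(1)]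
          point_mult_D[OF point_rp[OF V]] m(1) f(2) by blast
    qed
    then show "sp U = rp V" using point_maximal point_sp[OF U] point_rp[OF V] by blast
  next
    assume eq: "sp U = rp V"
    show "\<forall>m\<in>U. \<forall>n\<in>V. m * n \<noteq> 0"
    proof (intro ballI notI)
      fix m n assume mn: "m \<in> U" "n \<in> V" "m * n = 0"
      have "m\<^sup>\<dagger> * m * (n * n\<^sup>\<dagger>) \<in> sp U"
        using pointD(4)[OF point_sp[OF U]] UF_dagger_mem_sp[OF U mn(1)] UF_dagger_mem_rp[OF V mn(2)] eq
        by metis
      moreover have "m\<^sup>\<dagger> * m * (n * n\<^sup>\<dagger>) = 0"
      proof -
        have "m\<^sup>\<dagger> * m * (n * n\<^sup>\<dagger>) = m\<^sup>\<dagger> * (m * n) * n\<^sup>\<dagger>" by (simp add: mult.assoc)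
        then show ?thesis using mn(3) by simp
      qed
      ultimately show False using pointD(3)[OF point_sp[OF U]] by blast
    qed
  qed
  then show ?thesis unfolding Sigma_groupoid_def by auto
qed

lemma composable_nz: "(U, V) \<in> composables S \<Longrightarrow> m \<in> U \<Longrightarrow> n \<in> V \<Longrightarrow> m * n \<noteq> 0"
  by (auto simp: Sigma_groupoid_def)

text \<open>
  A product \<open>a * b\<close> of arbitrary members agrees with \<open>n * m\<close> near \<open>sp V\<close>: the element of \<open>sp U = rp V\<close> on
  which \<open>a\<close> and \<open>n\<close> agree fixes some \<open>b' \<in> V\<close> from the left, and \<open>b\<close>, \<open>m\<close>, \<open>b'\<close> all agree near \<open>sp V\<close>.
\<close>

lemma Umult_germ:
  assumes c: "(U, V) \<in> composables S" and n: "n \<in> U" and m: "m \<in> V"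
  shows "(n * m)\<^sup>\<dagger> * (n * m) \<in> sp V" "Umult U V = germ (n * m) (sp V)"
proof -
  have U: "U \<in> UF" and V: "V \<in> UF" and eq: "sp U = rp V" using c composable_iff by blast+
  have nmN: "n * m \<in> N" using U V n m UF_N mult_N by blast
  show dm: "(n * m)\<^sup>\<dagger> * (n * m) \<in> sp V"
  proof (rule dagger_mem_point[OF point_sp[OF V] nmN])
    fix f assume "f \<in> sp V"
    then show "n * m * f \<noteq> 0" using composable_nz[OF c n sp_mult_mem[OF V m]] by (simp add: mult.assoc)
  qed
  show "Umult U V = germ (n * m) (sp V)"
  proof (intro equalityI subsetI)
    fix c assume "c \<in> germ (n * m) (sp V)"
    then obtain f where f: "c \<in> N" "f \<in> sp V" "c * f = n * m * f" by (auto simp: germ_def)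
    have "m * f \<in> V" using sp_mult_mem[OF V m f(2)] .
    moreover have "nle B (n * (m * f)) c"
      using nle_rightI[OF f(1), of f] f by (simp add: sp_def mult.assoc)
    ultimately show "c \<in> Umult U V" using f(1) n unfolding Umult_def up_def by blast
  next
    fix c assume "c \<in> Umult U V"
    then obtain a b where ab: "c \<in> N" "a \<in> U" "b \<in> V" "nle B (a * b) c"
      unfolding Umult_def up_def by blast
    obtain g where g: "g \<in> rp V" "a * g = n * g" using UF_common[OF U ab(2) n] eq by auto
    \<comment> \<open>Inserting \<open>b'\<close> allows \<open>a\<close> to be replaced by \<open>n\<close>, as \<open>g\<close> fixes it from the left.\<close>
    obtain b' where b': "b' \<in> V" "g * b' = b'" using g by (auto simp: rp_def)
    obtain f where f: "f \<in> sp V" "b * f = m * f" using UF_common[OF V ab(3) m] by blast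
    obtain f' where f': "f' \<in> sp V" "b' * f' = m * f'" using UF_common[OF V b'(1) m] by blast
    \<comment> \<open>On \<open>h\<close> the three elements \<open>b\<close>, \<open>b'\<close> and \<open>m\<close> coincide.\<close>
    define h where "h = f * f'"
    have hI: "f \<in> I" "f' \<in> I" using f f' by (auto simp: sp_def)
    have bh: "b * h = m * h" "b' * h = m * h" unfolding h_def
      using f(2) f'(2) I_right_commute[OF hI] by (simp_all flip: mult.assoc)
    have gb: "g * (b' * h) = b' * h" using b'(2) by (simp flip: mult.assoc)
    have "a * b * h = a * (b' * h)" using bh by (simp add: mult.assoc)
    also have "\<dots> = (a * g) * (b' * h)" using gb by (simp add: mult.assoc)
    also have "\<dots> = n * (b' * h)" using gb g(2) by (simp add: mult.assoc)
    also have "\<dots> = n * m * h" using bh by (simp add: mult.assoc)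
    finally have "a * b \<in> germ (n * m) (sp V)"
      using pointD(4)[OF point_sp[OF V] f(1) f'(1)] ab U V UF_N mult_N unfolding germ_def h_def by blast
    then show "c \<in> germ (n * m) (sp V)"
      using germ_UF(1)[OF point_sp[OF V] nmN dm] UF_up ab by blast
  qed
qed

lemma Umult_UF: assumes c: "(U, V) \<in> composables S"
  shows "Umult U V \<in> UF" "sp (Umult U V) = sp V"
    "n \<in> U \<Longrightarrow> m \<in> V \<Longrightarrow> n * m \<in> Umult U V"
proof -
  have UV: "U \<in> UF" "V \<in> UF" using c composable_iff by blast+
  have *: "Umult U V \<in> UF \<and> sp (Umult U V) = sp V \<and> n * m \<in> Umult U V" if "n \<in> U" "m \<in> V" for n m
    using Umult_germ[OF c that] germ_UF[OF point_sp[OF UV(2)]] that UV UF_N mult_N by metis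
  show "n \<in> U \<Longrightarrow> m \<in> V \<Longrightarrow> n * m \<in> Umult U V" using * by blast
  have "U \<noteq> {}" "V \<noteq> {}" using UF_nonempty UV by blast+
  then show "Umult U V \<in> UF" "sp (Umult U V) = sp V" using * by auto
qed

lemma Uinv_composable: assumes "(U, V) \<in> composables S" shows "(Uinv V, Uinv U) \<in> composables S"
  using assms by (auto simp: composable_iff Uinv_UF sp_Uinv rp_Uinv)

lemma Uinv_Umult: assumes c: "(U, V) \<in> composables S"
  shows "Uinv (Umult U V) = Umult (Uinv V) (Uinv U)"
proof -
  have UV: "U \<in> UF" "V \<in> UF" using c composable_iff by blast+
  have "Uinv (Umult U V) \<subseteq> Umult (Uinv V) (Uinv U)"
  proof
    fix k assume "k \<in> Uinv (Umult U V)"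
    then obtain c a b where *: "k = c\<^sup>\<dagger>" "c \<in> N" "a \<in> U" "b \<in> V" "nle B (a * b) c"
      unfolding Umult_def up_def by blast
    have "a \<in> N" "b \<in> N" using * UV UF_N by blast+
    then have "nle B (b\<^sup>\<dagger> * a\<^sup>\<dagger>) k" using * nle_dagger dagger_mult mult_N by metis
    then show "k \<in> Umult (Uinv V) (Uinv U)" using * dagger_N unfolding Umult_def up_def by blast
  qed
  then show ?thesis
    using UF_maximal[OF Uinv_UF[OF Umult_UF(1)[OF c]]] Umult_UF(1)[OF Uinv_composable[OF c]] UF_filter
    by metis
qed

lemma rp_Umult: assumes c: "(U, V) \<in> composables S" shows "rp (Umult U V) = rp U"
proof -
  have UV: "U \<in> UF" "V \<in> UF" using c composable_iff by blast+
  have "rp (Umult U V) = sp (Umult (Uinv V) (Uinv U))"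
    using Uinv_Umult[OF c] sp_Uinv[OF Umult_UF(1)[OF c]] by simp
  then show ?thesis using Umult_UF(2)[OF Uinv_composable[OF c]] sp_Uinv UV by simp
qed

lemma inv_composable_S: assumes "U \<in> UF" shows "(Uinv U, U) \<in> composables S" "(U, Uinv U) \<in> composables S"
  using assms by (auto simp: composable_iff Uinv_UF sp_Uinv rp_Uinv)

lemma inv_mult_cancel_S: assumes c: "(U, V) \<in> composables S"
  shows "Umult (Uinv U) (Umult U V) = V"
proof -
  have UV: "U \<in> UF" "V \<in> UF" using c composable_iff by blast+
  obtain n m where nm: "n \<in> U" "m \<in> V" using UF_nonempty UV by blast
  have c2: "(Uinv U, Umult U V) \<in> composables S"
    using UV c by (simp add: composable_iff Uinv_UF Umult_UF(1) sp_Uinv rp_Umult)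
  have N: "n \<in> N" "m \<in> N" using nm UV UF_N by blast+
  have "n\<^sup>\<dagger> * (n * m) \<in> Umult (Uinv U) (Umult U V)"
    using Umult_UF(3)[OF c2] Umult_UF(3)[OF c] nm by blast
  moreover have "nle B (n\<^sup>\<dagger> * (n * m)) m"
    using nle_leftI[OF N(2) dagger_I(1)[OF N(1)]] by (simp add: mult.assoc)
  ultimately have "m \<in> Umult (Uinv U) (Umult U V)" using UF_up Umult_UF(1)[OF c2] N by blast
  then show ?thesis using UF_eqI[OF Umult_UF(1)[OF c2] UV(2)] nm Umult_UF(2) c c2 by simp
qed

lemma groupoid_S: "groupoid S"
proof
  show "composables S \<subseteq> arrows S \<times> arrows S" by (auto simp: composable_iff S_sel)
  fix g h k
  show "(g, h) \<in> composables S \<Longrightarrow> gmult S g h \<in> arrows S" by (simp add: S_sel Umult_UF)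
  show "g \<in> arrows S \<Longrightarrow> ginv S g \<in> arrows S" by (simp add: S_sel Uinv_UF)
  show "g \<in> arrows S \<Longrightarrow> ginv S (ginv S g) = g" by (simp add: S_sel Uinv_Uinv)
  show "g \<in> arrows S \<Longrightarrow> (ginv S g, g) \<in> composables S \<and> (g, ginv S g) \<in> composables S"
    by (simp add: S_sel inv_composable_S)
  show "(g, h) \<in> composables S \<Longrightarrow> gmult S (ginv S g) (gmult S g h) = h"
    by (simp add: S_sel inv_mult_cancel_S)
  show "gmult S (gmult S g h) (ginv S h) = g" if c: "(g, h) \<in> composables S"
  proof -
    have gh: "g \<in> UF" "h \<in> UF" using c composable_iff by blast+
    have c2: "(Umult g h, Uinv h) \<in> composables S"
      using c by (simp add: composable_iff Umult_UF Uinv_UF rp_Uinv)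
    have "Uinv (Umult (Umult g h) (Uinv h)) = Uinv g"
      using Uinv_Umult[OF c2] Uinv_Umult[OF c] inv_mult_cancel_S[OF Uinv_composable[OF c]] by simp
    then show ?thesis using Uinv_Uinv[OF gh(1)] Uinv_Uinv[OF Umult_UF(1)[OF c2]] by (simp add: S_sel)
  qed
  assume c: "(g, h) \<in> composables S" "(h, k) \<in> composables S"
  then show *: "(gmult S g h, k) \<in> composables S \<and> (g, gmult S h k) \<in> composables S"
    by (simp add: S_sel composable_iff Umult_UF rp_Umult)
  have "g \<noteq> {}" "h \<noteq> {}" "k \<noteq> {}" using c composable_iff UF_nonempty by blast+
  then obtain a b d where abd: "a \<in> g" "b \<in> h" "d \<in> k" by blast
  have "a * b * d \<in> Umult (Umult g h) k" "a * (b * d) \<in> Umult g (Umult h k)"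
    using * c abd by (simp_all add: Umult_UF(3) S_sel)
  then show "gmult S (gmult S g h) k = gmult S g (gmult S h k)"
    using UF_eqI[of "Umult (Umult g h) k" "Umult g (Umult h k)"] Umult_UF * c
    by (simp add: S_sel mult.assoc)
qed

end

section \<open>The topology on ultrafilters\<close>

lemma continuous_map_nbhdI:
  assumes "\<And>x. x \<in> topspace X \<Longrightarrow> f x \<in> topspace Y"
    and "\<And>x V. x \<in> topspace X \<Longrightarrow> openin Y V \<Longrightarrow> f x \<in> V \<Longrightarrow>
      \<exists>U. openin X U \<and> x \<in> U \<and> (\<forall>y\<in>U. f y \<in> V)"
  shows "continuous_map X Y f"
  unfolding continuous_map_eq_topcontinuous_at topcontinuous_at_def using assms by blast

lemma homeomorphic_map_restrict_open:
  assumes f: "continuous_map X Y f" "open_map X Y f" and U: "openin X U" "inj_on f U"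
  shows "openin Y (f ` U)" "homeomorphic_map (subtopology X U) (subtopology Y (f ` U)) f"
proof -
  show fU: "openin Y (f ` U)" using f(2) U(1) by (simp add: open_map_def)
  have top: "topspace (subtopology X U) = U" "topspace (subtopology Y (f ` U)) = f ` U"
    using openin_subset[OF U(1)] openin_subset[OF fU] by (simp_all add: Int_absorb1)
  show "homeomorphic_map (subtopology X U) (subtopology Y (f ` U)) f"
  proof (rule bijective_open_imp_homeomorphic_map)
    show "continuous_map (subtopology X U) (subtopology Y (f ` U)) f"
      using f(1) by (auto simp: continuous_map_in_subtopology continuous_map_from_subtopology)
    show "open_map (subtopology X U) (subtopology Y (f ` U)) f"
      unfolding open_map_def
    proof (intro allI impI)
      fix W assume "openin (subtopology X U) W"
      then have "openin X W" "W \<subseteq> U" using U(1) by (simp_all add: openin_open_subtopology)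
      then show "openin (subtopology Y (f ` U)) (f ` W)"
        using f(2) fU by (auto simp: openin_open_subtopology open_map_def)
    qed
  qed (use top U(2) in auto)
qed

context local_unit_subring begin

lemma gsource_S: "gsource S U = Umult (Uinv U) U"
  and grange_S: "grange S U = Umult U (Uinv U)"
  by (simp_all add: gsource_def grange_def S_sel)

lemma gsource_S_UF: assumes "U \<in> UF"
  shows "gsource S U \<in> UF" "sp (gsource S U) = sp U" "rp (gsource S U) = sp U"
    "n \<in> U \<Longrightarrow> n\<^sup>\<dagger> * n \<in> gsource S U"
  using inv_composable_S[OF assms] by (auto simp: gsource_S Umult_UF rp_Umult rp_Uinv assms)

lemma grange_S_UF: assumes "U \<in> UF"
  shows "grange S U \<in> UF" "sp (grange S U) = rp U" "rp (grange S U) = rp U"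
    "n \<in> U \<Longrightarrow> n * n\<^sup>\<dagger> \<in> grange S U"
  using inv_composable_S[OF assms] by (auto simp: grange_S Umult_UF rp_Umult sp_Uinv assms)

lemma gunits_S_iff: "U \<in> gunits S \<longleftrightarrow> U \<in> UF \<and> (\<exists>e\<in>I. e \<in> U)"
proof
  assume "U \<in> gunits S"
  then obtain V where V: "V \<in> UF" "U = gsource S V" by (auto simp: gunits_def S_sel)
  obtain n where "n \<in> V" using UF_nonempty[OF V(1)] by blast
  then show "U \<in> UF \<and> (\<exists>e\<in>I. e \<in> U)" using V gsource_S_UF dagger_I UF_N by blast
next
  assume "U \<in> UF \<and> (\<exists>e\<in>I. e \<in> U)"
  then obtain e where U: "U \<in> UF" and e: "e \<in> I" "e \<in> U" by blast
  have "e \<in> gsource S U" using gsource_S_UF(4)[OF U e(2)] e(1) by (simp add: dagger_of_I I_D)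
  then have "gsource S U = U" using UF_eqI[of "gsource S U" U e] gsource_S_UF U e by blast
  then show "U \<in> gunits S" using U by (metis gunits_def S_sel(1) imageI)
qed

lemma unit_UF: "U \<in> gunits S \<Longrightarrow> U \<in> UF" by (simp add: gunits_S_iff)

lemma unit_contains_sp: assumes "U \<in> gunits S" "e \<in> sp U" shows "e \<in> U"
proof -
  obtain f where f: "U \<in> UF" "f \<in> I" "f \<in> U" using assms gunits_S_iff by blast
  have e: "e \<in> I" using assms by (simp add: sp_def)
  have "f * e \<in> U" using sp_mult_mem f assms by blast
  then show ?thesis using UF_up[OF f(1) _ I_N[OF e]] nle_leftI[OF I_N[OF e] f(2)] by blast
qed

lemma unit_eqI: assumes "U \<in> gunits S" "V \<in> gunits S" "sp U = sp V" shows "U = V"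
proof -
  have UV: "U \<in> UF" "V \<in> UF" using assms unit_UF by blast+
  obtain e where "e \<in> sp U" using pointD(2)[OF point_sp[OF UV(1)]] by blast
  then have "e \<in> U" "e \<in> V" using unit_contains_sp assms by simp_all
  then show ?thesis using UF_eqI[OF UV assms(3)] by blast
qed

lemma unit_rp: assumes "U \<in> gunits S" shows "rp U = sp U"
proof -
  have U: "U \<in> UF" using assms unit_UF by blast
  have "sp U \<subseteq> rp U"
  proof
    fix e assume e: "e \<in> sp U"
    have "e \<in> I" using e by (simp add: sp_def)
    then show "e \<in> rp U" using unit_contains_sp[OF assms e] I_D(2)[of e] by (auto simp: rp_def)
  qed
  then show ?thesis using point_maximal[OF point_sp[OF U] point_rp[OF U]] by blast
qed

lemma gsource_S_unit: "U \<in> UF \<Longrightarrow> gsource S U \<in> gunits S"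
  by (simp add: gunits_def S_sel)

lemma grange_S_unit: "U \<in> UF \<Longrightarrow> grange S U \<in> gunits S"
  using gsource_S_unit[OF Uinv_UF] by (simp add: grange_S gsource_S Uinv_Uinv)

lemma grange_of_unit: assumes "U \<in> gunits S" shows "grange S U = U"
  using unit_eqI[OF grange_S_unit assms] assms by (simp add: unit_UF grange_S_UF unit_rp)

lemma unit_mult: assumes "U \<in> UF"
  shows "(grange S U, U) \<in> composables S" "Umult (grange S U) U = U"
    "(U, gsource S U) \<in> composables S" "Umult U (gsource S U) = U"
proof -
  show 1: "(grange S U, U) \<in> composables S" and 2: "(U, gsource S U) \<in> composables S"
    using assms by (simp_all add: composable_iff grange_S_UF gsource_S_UF)
  obtain n where n: "n \<in> U" "n \<in> N" using UF_nonempty[OF assms] UF_N[OF assms] by blast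
  have "n * n\<^sup>\<dagger> * n \<in> Umult (grange S U) U" "n * (n\<^sup>\<dagger> * n) \<in> Umult U (gsource S U)"
    using Umult_UF(3)[OF 1 grange_S_UF(4)[OF assms n(1)] n(1)]
      Umult_UF(3)[OF 2 n(1) gsource_S_UF(4)[OF assms n(1)]] by simp_all
  then have "n \<in> Umult (grange S U) U" "n \<in> Umult U (gsource S U)"
    using dagger_mult_cancel[OF n(2)] by simp_all
  then show "Umult (grange S U) U = U" "Umult U (gsource S U) = U"
    using UF_eqI[OF Umult_UF(1)[OF 1] assms _ _ n(1)] UF_eqI[OF Umult_UF(1)[OF 2] assms _ _ n(1)]
      Umult_UF(2)[OF 1] Umult_UF(2)[OF 2] gsource_S_UF assms by auto
qed

text \<open>
  The inverse of the germ of \<open>n\<^sup>\<dagger>\<close> at the given unit. This is what makes the range map open.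
\<close>

lemma UF_with_range:
  assumes u: "u \<in> gunits S" and n: "n \<in> N" "n * n\<^sup>\<dagger> \<in> u"
  obtains U where "U \<in> UF" "n \<in> U" "grange S U = u"
proof -
  have uF: "u \<in> UF" using u unit_UF by blast
  have "n * n\<^sup>\<dagger> * (n * n\<^sup>\<dagger>) = n * n\<^sup>\<dagger>" using dagger_I(2)[OF n(1)] I_D by blast
  then have "n * n\<^sup>\<dagger> \<in> sp u" using n dagger_I(2)[OF n(1)] unfolding sp_def by blast
  then have x: "(n\<^sup>\<dagger>)\<^sup>\<dagger> * n\<^sup>\<dagger> \<in> sp u" using dagger_dagger[OF n(1)] by simp
  let ?V = "germ (n\<^sup>\<dagger>) (sp u)"
  have V: "?V \<in> UF" "n\<^sup>\<dagger> \<in> ?V" "sp ?V = sp u"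
    using germ_UF[OF point_sp[OF uF] dagger_N[OF n(1)] x] by auto
  have "n \<in> Uinv ?V" using V(2) dagger_dagger[OF n(1)] by (metis imageI)
  moreover have "grange S (Uinv ?V) = u"
    using unit_eqI[OF grange_S_unit[OF Uinv_UF[OF V(1)]] u] V
    by (simp add: grange_S_UF Uinv_UF rp_Uinv)
  ultimately show ?thesis using that Uinv_UF[OF V(1)] by blast
qed

definition cyl :: "'a \<Rightarrow> 'a set set" where "cyl n = {U \<in> UF. n \<in> U}"

lemma gtop_S: "gtop S = topology_generated_by (cyl ` N)"
  by (simp add: Sigma_groupoid_def cyl_def)

text \<open>
  The sets \<open>cyl n\<close> form a basis because ultrafilters are down-directed: below two members \<open>n\<close>, \<open>m\<close> there is
  a third one \<open>p\<close>, and \<open>cyl p\<close> is contained in \<open>cyl n \<inter> cyl m\<close>.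
\<close>

lemma openin_S: "openin (gtop S) W \<longleftrightarrow> W \<subseteq> UF \<and> (\<forall>U\<in>W. \<exists>n\<in>U. cyl n \<subseteq> W)"
proof
  assume "openin (gtop S) W"
  then have "generate_topology_on (cyl ` N) W"
    by (simp add: gtop_S openin_topology_generated_by_iff)
  then show "W \<subseteq> UF \<and> (\<forall>U\<in>W. \<exists>n\<in>U. cyl n \<subseteq> W)"
  proof induction
    case (Int a b)
    have "\<exists>n\<in>U. cyl n \<subseteq> a \<inter> b" if U: "U \<in> a \<inter> b" for U
    proof -
      have "U \<in> a" "U \<in> b" using U by auto
      then obtain n m where nm: "n \<in> U" "cyl n \<subseteq> a" "m \<in> U" "cyl m \<subseteq> b" "U \<in> UF"
        using Int.IH by (metis subsetD)
      then obtain p where p: "p \<in> U" "nle B p n" "nle B p m" using UF_directed by blast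
      have "n \<in> N" "m \<in> N" using nm UF_N by blast+
      then have "cyl p \<subseteq> cyl n" "cyl p \<subseteq> cyl m" using p UF_up unfolding cyl_def by blast+
      then show ?thesis using nm p by blast
    qed
    then show ?case using Int.IH by auto
  next
    case (UN K)
    show ?case
    proof (intro conjI ballI)
      show "\<Union>K \<subseteq> UF" using UN.IH by blast
      fix U assume "U \<in> \<Union>K"
      then obtain k n where "k \<in> K" "n \<in> U" "cyl n \<subseteq> k" using UN.IH by blast
      then show "\<exists>n\<in>U. cyl n \<subseteq> \<Union>K" by blast
    qed
  next
    case (Basis s)
    then show ?case by (auto simp: cyl_def)
  qed simp
next
  assume W: "W \<subseteq> UF \<and> (\<forall>U\<in>W. \<exists>n\<in>U. cyl n \<subseteq> W)"
  have "W = \<Union>(cyl ` {n \<in> N. cyl n \<subseteq> W})"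
  proof (intro equalityI subsetI)
    fix U assume "U \<in> W"
    then obtain n where "n \<in> U" "cyl n \<subseteq> W" "U \<in> UF" "n \<in> N" using W UF_N by blast
    then show "U \<in> \<Union>(cyl ` {n \<in> N. cyl n \<subseteq> W})" unfolding cyl_def by blast
  qed blast
  moreover have "openin (gtop S) (\<Union>(cyl ` {n \<in> N. cyl n \<subseteq> W}))"
    unfolding gtop_S by (rule openin_Union) (auto intro: topology_generated_by_Basis)
  ultimately show "openin (gtop S) W" by simp
qed

lemma openin_cyl: "openin (gtop S) (cyl n)"
  unfolding openin_S cyl_def by blast

lemma topspace_S: "topspace (gtop S) = UF"
proof -
  have "openin (gtop S) UF" using UF_nonempty unfolding openin_S cyl_def by blast
  then show ?thesis using openin_S openin_subset openin_topspace by (metis subset_antisym)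
qed

lemma openin_S_cyl: assumes "openin (gtop S) W" "U \<in> W"
  obtains n where "n \<in> U" "n \<in> N" "cyl n \<subseteq> W" "U \<in> UF"
  using assms openin_S UF_N by (metis subsetD)

lemma cyl_disjoint:
  assumes "e \<in> I" "f \<in> I" "e * f = 0" shows "cyl (m * e) \<inter> cyl (n * f) = {}"
proof (rule ccontr)
  assume "cyl (m * e) \<inter> cyl (n * f) \<noteq> {}"
  then obtain U where U: "U \<in> UF" "m * e \<in> U" "n * f \<in> U" unfolding cyl_def by blast
  have "e \<in> sp U" "f \<in> sp U" unfolding sp_def using U assms I_idem_right by blast+
  then show False using pointD(3,4)[OF point_sp[OF U(1)]] assms(3) by metis
qed

lemma points_separated:
  assumes "point x" "point y" "x \<noteq> y" obtains e f where "e \<in> x" "f \<in> y" "e \<in> I" "f \<in> I" "e * f = 0"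
proof -
  obtain e where e: "e \<in> x" "e \<notin> y" using point_maximal assms by blast
  obtain f where f: "f \<in> y" using pointD(2)[OF assms(2)] by blast
  have I: "e \<in> I" "f \<in> I" using e f pointD(1) assms by blast+
  have "f - f * e \<in> y" using pointD(6)[OF assms(2) f I(1)] point_mult_D[OF assms(2)] I e by blast
  then show ?thesis using that e I diff_I diff_I_annihilates by blast
qed

lemma topological_groupoid_S: "topological_groupoid S"
proof -
  interpret groupoid S by (rule groupoid_S)
  show ?thesis
  proof
    show "topspace (gtop S) = arrows S" by (simp add: topspace_S S_sel)
    show "continuous_map (gtop S) (gtop S) (ginv S)"
    proof (rule continuous_map_nbhdI)
      fix U V assume U: "U \<in> topspace (gtop S)" and V: "openin (gtop S) V" "ginv S U \<in> V"
      obtain n where n: "n \<in> Uinv U" "n \<in> N" "cyl n \<subseteq> V" "Uinv U \<in> UF"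
        by (rule openin_S_cyl[OF V, unfolded S_sel])
      have UF: "U \<in> UF" using U by (simp add: topspace_S)
      have "n\<^sup>\<dagger> \<in> U" using n Uinv_mem[OF UF dagger_N] dagger_dagger by simp
      then have "U \<in> cyl (n\<^sup>\<dagger>)" using UF by (simp add: cyl_def)
      moreover have "ginv S W \<in> V" if W: "W \<in> cyl (n\<^sup>\<dagger>)" for W
      proof -
        have "W \<in> UF" "n\<^sup>\<dagger> \<in> W" using W by (auto simp: cyl_def)
        then have "Uinv W \<in> cyl n" using Uinv_UF Uinv_mem[OF _ dagger_N[OF n(2)]] dagger_dagger[OF n(2)]
          by (auto simp: cyl_def)
        then show ?thesis using n by (auto simp: S_sel)
      qed
      ultimately show "\<exists>Z. openin (gtop S) Z \<and> U \<in> Z \<and> (\<forall>y\<in>Z. ginv S y \<in> V)"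
        using openin_cyl by blast
    qed (simp add: topspace_S S_sel Uinv_UF)
    show "continuous_map (subtopology (prod_topology (gtop S) (gtop S)) (composables S)) (gtop S)
       (\<lambda>(g, h). gmult S g h)"
    proof (rule continuous_map_nbhdI)
      fix z V
      assume z: "z \<in> topspace (subtopology (prod_topology (gtop S) (gtop S)) (composables S))"
        and V: "openin (gtop S) V" "(case z of (g, h) \<Rightarrow> gmult S g h) \<in> V"
      obtain U W where UW: "z = (U, W)" "(U, W) \<in> composables S" using z by (cases z) auto
      obtain n where n: "n \<in> Umult U W" "n \<in> N" "cyl n \<subseteq> V" "Umult U W \<in> UF"
        by (rule openin_S_cyl[OF V, unfolded UW(1) S_sel prod.case])
      then obtain a b where ab: "a \<in> U" "b \<in> W" "nle B (a * b) n" unfolding Umult_def up_def by blast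
      have UF: "U \<in> UF" "W \<in> UF" using UW(2) composable_iff by blast+
      let ?Z = "(cyl a \<times> cyl b) \<inter> composables S"
      have "openin (subtopology (prod_topology (gtop S) (gtop S)) (composables S)) ?Z"
        by (intro openin_subtopology_Int) (simp add: openin_prod_Times_iff openin_cyl)
      moreover have "z \<in> ?Z" using UW ab UF by (auto simp: cyl_def)
      moreover have "gmult S g h \<in> V" if gh: "(g, h) \<in> ?Z" for g h
      proof -
        have "Umult g h \<in> UF" "a * b \<in> Umult g h" using gh Umult_UF by (auto simp: cyl_def)
        then have "Umult g h \<in> cyl n" using UF_up ab n by (auto simp: cyl_def)
        then show ?thesis using n by (auto simp: S_sel)
      qed
      ultimately show "\<exists>Z. openin (subtopology (prod_topology (gtop S) (gtop S)) (composables S)) Z \<and>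
          z \<in> Z \<and> (\<forall>y\<in>Z. (case y of (g, h) \<Rightarrow> gmult S g h) \<in> V)"
        by (intro exI[of _ ?Z]) force
    qed (auto simp: topspace_S S_sel Umult_UF)
  qed
qed

lemma openin_gunits_S: "openin (gtop S) (gunits S)"
  unfolding openin_S cyl_def using gunits_S_iff by blast

end

section \<open>The action of the scalar units\<close>

locale algebra_with_local_units = r_algebra smul + local_unit_subring B
  for smul :: "'r::{comm_ring,comm_monoid_mult} \<Rightarrow> 'a::ring \<Rightarrow> 'a" and B :: "'a set" +
  assumes smul_B: "b \<in> B \<Longrightarrow> smul t b \<in> B"
    and WT_B: "WT smul B"
begin

abbreviation RU :: "'r set" where "RU \<equiv> unit_group"
abbreviation sact :: "'r \<Rightarrow> 'a set \<Rightarrow> 'a set" where "sact t U \<equiv> smul t ` U"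

lemma smul_zero_right: "smul t 0 = 0"
  using scale_right_distrib[of t 0 0] by simp

lemma smul_diff_left: "smul (t - u) a = smul t a - smul u a"
  using scale_left_distrib[of "t - u" u a] by simp

lemma unit_inv: assumes "t \<in> RU" shows "t * unit_inv t = 1" "unit_inv t * t = 1"
proof -
  obtain u where u: "t * u = 1" using assms by (auto simp: unit_group_def dvd_def)
  have "v = u" if "t * v = 1" for v
  proof -
    have "v = v * (t * u)" using u by simp
    also have "\<dots> = (t * v) * u" by (simp add: mult_ac)
    finally show ?thesis using that by simp
  qed
  then show "t * unit_inv t = 1" unfolding unit_inv_def using u by (metis (mono_tags, lifting) theI)
  then show "unit_inv t * t = 1" by (simp add: mult.commute)
qed

lemma RU_I: "t * u = 1 \<Longrightarrow> t \<in> RU"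
  unfolding unit_group_def by (metis dvdI mem_Collect_eq)

lemma RU_mult: assumes "t \<in> RU" "u \<in> RU" shows "t * u \<in> RU"
proof (rule RU_I)
  have "t * u * (unit_inv t * unit_inv u) = (t * unit_inv t) * (u * unit_inv u)" by (simp add: mult_ac)
  then show "t * u * (unit_inv t * unit_inv u) = 1" using assms unit_inv by simp
qed

lemma RU_one: "1 \<in> RU" by (rule RU_I[of 1 1]) simp

lemma RU_inv: "t \<in> RU \<Longrightarrow> unit_inv t \<in> RU"
  using unit_inv RU_I by blast

lemma smul_inv: assumes "t \<in> RU"
  shows "smul t (smul (unit_inv t) a) = a" "smul (unit_inv t) (smul t a) = a"
  using unit_inv[OF assms] by (simp_all add: scale_scale scale_one)

lemma normal_inverse_smul:
  assumes t: "t \<in> RU" and n: "normal_inverse B n k"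
  shows "normal_inverse B (smul t n) (smul (unit_inv t) k)"
  using n unit_inv[OF t] unfolding normal_inverse_def
  by (simp add: scale_mult_left scale_mult_right scale_scale scale_one mult.assoc[symmetric])

lemma smul_N: "t \<in> RU \<Longrightarrow> n \<in> N \<Longrightarrow> smul t n \<in> N"
  using normal_inverse_smul normal_inverse_dagger normal_inverse_N by blast

lemma dagger_smul: "t \<in> RU \<Longrightarrow> n \<in> N \<Longrightarrow> (smul t n)\<^sup>\<dagger> = smul (unit_inv t) (n\<^sup>\<dagger>)"
  using normal_inverse_smul normal_inverse_dagger dagger_eqI by blast

lemma nle_smul: assumes "t \<in> RU" "n \<in> N" "m \<in> N" "nle B n m" shows "nle B (smul t n) (smul t m)"
proof -
  obtain e where e: "e \<in> I" "n = e * m" using assms nle_iff_left by blast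
  then have "smul t n = e * smul t m" by (simp add: scale_mult_right)
  then show ?thesis using nle_leftI[OF smul_N[OF assms(1,3)] e(1)] by simp
qed

lemma sact_UF: assumes "t \<in> RU" "U \<in> UF" shows "sact t U \<in> UF"
  by (rule UF_image[of "smul t" "smul (unit_inv t)"])
    (use assms RU_inv in \<open>auto simp: smul_N smul_inv nle_smul smul_zero_right\<close>)

lemma sact_sact: "sact t (sact u U) = sact (t * u) U"
  by (simp add: image_image scale_scale)

lemma sact_one: "sact 1 U = U"
  by (simp add: scale_one)

lemma sact_inv: assumes "t \<in> RU" shows "sact (unit_inv t) (sact t U) = U" "sact t (sact (unit_inv t) U) = U"
  using unit_inv[OF assms] by (simp_all add: sact_sact sact_one)

lemma smul_mem_sact: assumes "t \<in> RU" shows "n \<in> sact t U \<longleftrightarrow> smul (unit_inv t) n \<in> U"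
proof
  assume "smul (unit_inv t) n \<in> U"
  then show "n \<in> sact t U" using smul_inv(1)[OF assms, of n] by (metis imageI)
qed (use smul_inv(2)[OF assms] in auto)

lemma sp_sact: assumes "t \<in> RU" shows "sp (sact t U) = sp U"
proof -
  have "smul t m * e = smul t m \<longleftrightarrow> m * e = m" for m e
    using smul_inv(2)[OF assms] by (metis scale_mult_left)
  then show ?thesis by (auto simp: sp_def)
qed

lemma rp_sact: assumes "t \<in> RU" shows "rp (sact t U) = rp U"
proof -
  have "e * smul t m = smul t m \<longleftrightarrow> e * m = m" for m e
    using smul_inv(2)[OF assms] by (metis scale_mult_right)
  then show ?thesis by (auto simp: rp_def)
qed

lemma composable_sact: assumes "t \<in> RU" "u \<in> RU" "U \<in> UF" "V \<in> UF"
  shows "(sact t U, sact u V) \<in> composables S \<longleftrightarrow> (U, V) \<in> composables S"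
  using assms by (simp add: composable_iff sact_UF sp_sact rp_sact)

lemma Umult_sact: assumes t: "t \<in> RU" "u \<in> RU" and c: "(U, V) \<in> composables S"
  shows "Umult (sact t U) (sact u V) = sact (t * u) (Umult U V)"
proof -
  have UV: "U \<in> UF" "V \<in> UF" using c composable_iff by blast+
  then have c2: "(sact t U, sact u V) \<in> composables S" using composable_sact c t by blast
  have "U \<noteq> {}" "V \<noteq> {}" using UV UF_nonempty by blast+
  then obtain n m where nm: "n \<in> U" "m \<in> V" by blast
  have "smul t n * smul u m = smul (t * u) (n * m)"
    by (simp add: scale_mult_left scale_mult_right scale_scale mult.commute)
  then have "smul (t * u) (n * m) \<in> Umult (sact t U) (sact u V)"
    using Umult_UF(3)[OF c2, of "smul t n" "smul u m"] nm by simp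
  moreover have "smul (t * u) (n * m) \<in> sact (t * u) (Umult U V)"
    using Umult_UF(3)[OF c nm] by simp
  ultimately show ?thesis
    using UF_eqI[OF Umult_UF(1)[OF c2] sact_UF[OF RU_mult[OF t] Umult_UF(1)[OF c]]]
      Umult_UF(2)[OF c] Umult_UF(2)[OF c2] sp_sact RU_mult t by simp
qed

lemma Uinv_sact: assumes "t \<in> RU" "U \<in> UF"
  shows "Uinv (sact t U) = sact (unit_inv t) (Uinv U)"
  using assms by (auto simp: image_image dagger_smul UF_N intro!: image_cong)

text \<open>
  This is the use of (WT): if \<open>t\<close> and \<open>u\<close> act alike on an ultrafilter, then \<open>t - u\<close> annihilates some member
  \<open>m\<close>, hence the nonzero idempotent \<open>m\<^sup>\<dagger> * m\<close>.
\<close>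

lemma sact_free: assumes "t \<in> RU" "u \<in> RU" "U \<in> UF" "sact t U = sact u U" shows "t = u"
proof -
  obtain n where n: "n \<in> U" using UF_nonempty[OF assms(3)] by blast
  have "smul t n \<in> sact t U" "smul u n \<in> sact t U" using n assms(4) by auto
  then obtain f where f: "f \<in> sp U" "smul t n * f = smul u n * f"
    using UF_common[OF sact_UF[OF assms(1,3)]] sp_sact[OF assms(1)] by metis
  let ?m = "n * f"
  have m: "?m \<in> U" using sp_mult_mem[OF assms(3) n f(1)] .
  let ?e = "?m\<^sup>\<dagger> * ?m"
  have e: "?e \<in> I" "?e \<noteq> 0"
    using UF_dagger_mem_sp[OF assms(3) m] pointD[OF point_sp[OF assms(3)]] by blast+
  have "smul (t - u) ?m = 0" using f(2) by (simp add: smul_diff_left scale_mult_left)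
  then have "smul (t - u) ?e = 0" by (metis scale_mult_right mult_zero_right)
  then have "t - u = 0" using WT_B e unfolding WT_def by blast
  then show ?thesis by simp
qed

section \<open>The quotient groupoid\<close>

abbreviation q :: "'a set \<Rightarrow> 'a set set" where "q \<equiv> Gq smul B"
abbreviation G :: "'a set set topgroupoid_struct" where "G \<equiv> G_groupoid smul B"

lemma usim_iff: "(U, W) \<in> usim smul B \<longleftrightarrow> U \<in> UF \<and> W \<in> UF \<and> (\<exists>t\<in>RU. U = sact t W)"
  by (simp add: usim_def)

lemma equiv_usim: "equiv UF (usim smul B)"
proof (rule equivI)
  show "refl_on UF (usim smul B)"
    unfolding refl_on_def usim_iff using RU_one sact_one by metis
  show "sym (usim smul B)"
    unfolding sym_def usim_iff using RU_inv sact_inv(1) by metis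
  show "trans (usim smul B)"
    unfolding trans_def usim_iff using RU_mult sact_sact by metis
  show "usim smul B \<subseteq> UF \<times> UF" by (auto simp: usim_iff)
qed

lemma q_eq_iff: assumes "U \<in> UF" "W \<in> UF" shows "q U = q W \<longleftrightarrow> (\<exists>t\<in>RU. U = sact t W)"
  using eq_equiv_class_iff[OF equiv_usim assms] assms unfolding Gq_def by (simp add: usim_iff)

lemma q_sact: "t \<in> RU \<Longrightarrow> U \<in> UF \<Longrightarrow> q (sact t U) = q U"
  using q_eq_iff sact_UF by blast

lemma arrows_G: "arrows G = q ` UF"
  by (auto simp: G_groupoid_def Let_def S_sel quotient_def Gq_def)

lemma composables_G: "composables G = map_prod q q ` composables S"
  by (simp add: G_groupoid_def Let_def)

lemma q_composable_iff: assumes "U \<in> UF" "W \<in> UF"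
  shows "(q U, q W) \<in> composables G \<longleftrightarrow> (U, W) \<in> composables S"
proof
  assume "(q U, q W) \<in> composables G"
  then obtain U' W' where c: "(U', W') \<in> composables S" "q U = q U'" "q W = q W'"
    by (auto simp: composables_G)
  have "U' \<in> UF" "W' \<in> UF" using c composable_iff by blast+
  then show "(U, W) \<in> composables S" using c assms by (auto simp: q_eq_iff composable_sact)
qed (auto simp: composables_G)

text \<open>
  Two pairs of representatives differ by scalars \<open>t\<close>, \<open>u\<close>, and their products by \<open>t * u\<close>, so the definite
  description of the product denotes.
\<close>

lemma q_mult: assumes c: "(U, W) \<in> composables S" shows "gmult G (q U) (q W) = q (Umult U W)"
proof -
  have UW: "U \<in> UF" "W \<in> UF" using c composable_iff by blast+
  have "z = q (Umult U W)"
    if "\<exists>U' W'. (U', W') \<in> composables S \<and> q U' = q U \<and> q W' = q W \<and> z = q (Umult U' W')" for z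
  proof -
    obtain U' W' where c': "(U', W') \<in> composables S" "q U' = q U" "q W' = q W" "z = q (Umult U' W')"
      using \<open>\<exists>U' W'. _ U' W'\<close> by blast
    have "U' \<in> UF" "W' \<in> UF" using c' composable_iff by blast+
    then obtain t u where "t \<in> RU" "u \<in> RU" "U' = sact t U" "W' = sact u W"
      using c' UW by (auto simp: q_eq_iff)
    then show ?thesis using c c' Umult_UF(1) by (simp add: Umult_sact q_sact RU_mult)
  qed
  moreover have "gmult G (q U) (q W) =
      (THE z. \<exists>U' W'. (U', W') \<in> composables S \<and> q U' = q U \<and> q W' = q W \<and> z = q (Umult U' W'))"
    by (simp add: G_groupoid_def Let_def S_sel)
  ultimately show ?thesis using c by (auto intro!: the_equality)
qed

lemma q_inv: assumes U: "U \<in> UF" shows "ginv G (q U) = q (Uinv U)"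
proof -
  have "z = q (Uinv U)" if "\<exists>U'\<in>UF. q U' = q U \<and> z = q (Uinv U')" for z
    using that U by (auto simp: q_eq_iff Uinv_sact q_sact RU_inv Uinv_UF)
  moreover have "ginv G (q U) = (THE z. \<exists>U'\<in>UF. q U' = q U \<and> z = q (Uinv U'))"
    by (simp add: G_groupoid_def Let_def S_sel)
  ultimately show ?thesis using U by (auto intro!: the_equality)
qed

lemma composable_G_E: assumes "(x, y) \<in> composables G"
  obtains U W where "x = q U" "y = q W" "(U, W) \<in> composables S"
  using assms by (auto simp: composables_G)

lemma groupoid_G: "groupoid G"
proof -
  interpret groupoid S by (rule groupoid_S)
  show ?thesis
  proof
    fix g h k
    show "composables G \<subseteq> arrows G \<times> arrows G"
      by (auto simp: composables_G arrows_G composable_iff)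
    show "(g, h) \<in> composables G \<Longrightarrow> gmult G g h \<in> arrows G"
      by (auto elim!: composable_G_E simp: q_mult arrows_G Umult_UF)
    show "g \<in> arrows G \<Longrightarrow> ginv G g \<in> arrows G" by (auto simp: arrows_G q_inv Uinv_UF)
    show "g \<in> arrows G \<Longrightarrow> ginv G (ginv G g) = g" by (auto simp: arrows_G q_inv Uinv_UF Uinv_Uinv)
    show "g \<in> arrows G \<Longrightarrow> (ginv G g, g) \<in> composables G \<and> (g, ginv G g) \<in> composables G"
      by (auto simp: arrows_G q_inv Uinv_UF q_composable_iff inv_composable_S)
    show "gmult G (ginv G g) (gmult G g h) = h" "gmult G (gmult G g h) (ginv G h) = g"
      if gh: "(g, h) \<in> composables G"
    proof -
      obtain U W where UW: "g = q U" "h = q W" and c: "(U, W) \<in> composables S"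
        using composable_G_E[OF gh] .
      have "U \<in> UF" "W \<in> UF" using c composable_iff by blast+
      moreover have "(Uinv U, Umult U W) \<in> composables S" "(Umult U W, Uinv W) \<in> composables S"
        using c by (auto simp: composable_iff Umult_UF Uinv_UF sp_Uinv rp_Uinv rp_Umult)
      ultimately show "gmult G (ginv G g) (gmult G g h) = h" "gmult G (gmult G g h) (ginv G h) = g"
        using UW c inv_mult_cancel[OF c, unfolded S_sel] mult_inv_cancel[OF c, unfolded S_sel]
        by (simp_all add: q_mult q_inv)
    qed
    assume gh: "(g, h) \<in> composables G" and hk: "(h, k) \<in> composables G"
    obtain U W where UW: "g = q U" "h = q W" and c: "(U, W) \<in> composables S"
      using composable_G_E[OF gh] .
    obtain X where X: "k = q X" "X \<in> UF" using hk by (auto simp: composables_G composable_iff)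
    have UF: "U \<in> UF" "W \<in> UF" using c composable_iff by blast+
    have d: "(W, X) \<in> composables S" using hk UW X UF q_composable_iff by simp
    have cd: "(Umult U W, X) \<in> composables S" "(U, Umult W X) \<in> composables S"
      using assoc_composable[OF c d, unfolded S_sel] by simp_all
    then show "(gmult G g h, k) \<in> composables G \<and> (g, gmult G h k) \<in> composables G"
      using UW X UF c d by (simp add: q_mult q_composable_iff Umult_UF)
    show "gmult G (gmult G g h) k = gmult G g (gmult G h k)"
      using UW X c d cd assoc[OF c d, unfolded S_sel] by (simp add: q_mult)
  qed
qed

lemma q_source: "U \<in> UF \<Longrightarrow> gsource G (q U) = q (gsource S U)"
  and q_range: "U \<in> UF \<Longrightarrow> grange G (q U) = q (grange S U)"
  by (simp_all add: gsource_def grange_def q_inv q_mult inv_composable_S S_sel)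

lemma gunits_G: "gunits G = q ` gunits S"
  by (auto simp: gunits_def arrows_G S_sel q_source image_image)

text \<open>
  Equivalent ultrafilters have the same source point, and a unit is determined by that point.
\<close>

lemma q_inj_units: assumes "U \<in> gunits S" "V \<in> gunits S" "q U = q V" shows "U = V"
proof -
  obtain t where "t \<in> RU" "U = sact t V" using assms q_eq_iff[of U V] unit_UF by auto
  then have "sp U = sp V" using sp_sact by simp
  then show ?thesis using unit_eqI assms by blast
qed

lemma gtop_G: "gtop G = quotient_top (gtop S) q"
  by (simp add: G_groupoid_def Let_def)

lemma quotient_map_q: "quotient_map (gtop S) (gtop G) q"
  unfolding gtop_G by (rule quotient_map_quotient_top)

lemma topspace_G: "topspace (gtop G) = arrows G"
  using quotient_imp_surjective_map[OF quotient_map_q] by (simp add: topspace_S arrows_G)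

lemma continuous_q: "continuous_map (gtop S) (gtop G) q"
  by (rule quotient_imp_continuous_map[OF quotient_map_q])

lemma openin_sact: assumes t: "t \<in> RU" and W: "openin (gtop S) W" shows "openin (gtop S) (sact t ` W)"
  unfolding openin_S
proof (intro conjI ballI)
  have WU: "W \<subseteq> UF" using W openin_S by blast
  then show "sact t ` W \<subseteq> UF" using sact_UF[OF t] by blast
  fix V assume "V \<in> sact t ` W"
  then obtain U where U: "U \<in> W" "V = sact t U" by blast
  then obtain n where n: "n \<in> U" "cyl n \<subseteq> W" using W openin_S by blast
  have "cyl (smul t n) \<subseteq> sact t ` W"
  proof
    fix X assume "X \<in> cyl (smul t n)"
    then have X: "X \<in> UF" "smul t n \<in> X" by (auto simp: cyl_def)
    have "n \<in> sact (unit_inv t) X" using X(2) smul_inv(2)[OF t, of n] by (metis imageI)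
    then have "sact (unit_inv t) X \<in> W" using n(2) sact_UF[OF RU_inv[OF t] X(1)] by (auto simp: cyl_def)
    then show "X \<in> sact t ` W" using sact_inv(2)[OF t, of X] by (metis imageI)
  qed
  then show "\<exists>n\<in>V. cyl n \<subseteq> sact t ` W" using n U by blast
qed

text \<open>
  The saturation of an open set is the union of its translates by scalar units.
\<close>

lemma open_map_q: "open_map (gtop S) (gtop G) q"
  unfolding open_map_def
proof (intro allI impI)
  fix W assume W: "openin (gtop S) W"
  then have WU: "W \<subseteq> UF" using openin_S by blast
  have "{U \<in> UF. q U \<in> q ` W} = (\<Union>t\<in>RU. sact t ` W)"
  proof (intro equalityI subsetI)
    fix U assume "U \<in> {U \<in> UF. q U \<in> q ` W}"
    then obtain V where "V \<in> W" "q U = q V" "U \<in> UF" by blast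
    then obtain t where "t \<in> RU" "U = sact t V" using WU q_eq_iff[of U V] by auto
    then show "U \<in> (\<Union>t\<in>RU. sact t ` W)" using \<open>V \<in> W\<close> by blast
  next
    fix U assume "U \<in> (\<Union>t\<in>RU. sact t ` W)"
    then obtain t V where "t \<in> RU" "V \<in> W" "U = sact t V" by blast
    then show "U \<in> {U \<in> UF. q U \<in> q ` W}" using WU sact_UF[of t V] q_sact[of t V] by auto
  qed
  moreover have "openin (gtop S) (\<Union>t\<in>RU. sact t ` W)"
    by (rule openin_Union) (use openin_sact W in auto)
  ultimately show "openin (gtop G) (q ` W)"
    using WU by (auto simp: gtop_G openin_quotient_top topspace_S)
qed

lemma openin_q_image: "openin (gtop S) W \<Longrightarrow> openin (gtop G) (q ` W)"
  using open_map_q by (simp add: open_map_def)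

lemma openin_q_vimage: "openin (gtop G) Z \<Longrightarrow> openin (gtop S) {U \<in> UF. q U \<in> Z}"
  by (simp add: gtop_G openin_quotient_top topspace_S)

lemma openin_gunits_G: "openin (gtop G) (gunits G)"
  using openin_q_image[OF openin_gunits_S] by (simp add: gunits_G)

lemma topological_groupoid_G: "topological_groupoid G"
proof -
  interpret S: topological_groupoid S by (rule topological_groupoid_S)
  interpret groupoid G by (rule groupoid_G)
  show ?thesis
  proof
    show "topspace (gtop G) = arrows G" by (rule topspace_G)
    have "continuous_map (gtop S) (gtop G) (q \<circ> Uinv)"
      using S.continuous_inv continuous_q continuous_map_compose by (metis S_sel(3))
    then have "continuous_map (gtop S) (gtop G) (ginv G \<circ> q)"
      by (rule continuous_map_eq) (simp add: topspace_S q_inv)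
    then show "continuous_map (gtop G) (gtop G) (ginv G)"
      using continuous_compose_quotient_map_eq[OF quotient_map_q] by blast
    show "continuous_map (subtopology (prod_topology (gtop G) (gtop G)) (composables G)) (gtop G)
       (\<lambda>(g, h). gmult G g h)"
    proof (rule continuous_map_nbhdI)
      fix z V
      assume z: "z \<in> topspace (subtopology (prod_topology (gtop G) (gtop G)) (composables G))"
        and V: "openin (gtop G) V" "(case z of (g, h) \<Rightarrow> gmult G g h) \<in> V"
      obtain U W where UW: "z = (q U, q W)" and c: "(U, W) \<in> composables S"
        using z by (auto simp: composables_G)
      have UF: "U \<in> UF" "W \<in> UF" using c composable_iff by blast+
      have UW_V: "Umult U W \<in> {U \<in> UF. q U \<in> V}" using V(2) UW c by (simp add: q_mult Umult_UF)
      obtain n where n: "n \<in> Umult U W" "n \<in> N" "cyl n \<subseteq> {U \<in> UF. q U \<in> V}" "Umult U W \<in> UF"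
        by (rule openin_S_cyl[OF openin_q_vimage[OF V(1)] UW_V])
      then obtain a b where ab: "n \<in> N" "a \<in> U" "b \<in> W" "nle B (a * b) n"
        unfolding Umult_def up_def by blast
      let ?Z = "(q ` cyl a \<times> q ` cyl b) \<inter> composables G"
      have "openin (subtopology (prod_topology (gtop G) (gtop G)) (composables G)) ?Z"
        by (intro openin_subtopology_Int) (simp add: openin_prod_Times_iff openin_q_image openin_cyl)
      moreover have "z \<in> ?Z" using UW ab UF c q_composable_iff by (auto simp: cyl_def)
      moreover have "gmult G g h \<in> V" if gh: "(g, h) \<in> ?Z" for g h
      proof -
        obtain U' W' where UW': "g = q U'" "h = q W'" "U' \<in> cyl a" "W' \<in> cyl b" using gh by auto
        then have "U' \<in> UF" "W' \<in> UF" "a \<in> U'" "b \<in> W'" by (auto simp: cyl_def)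
        moreover from this have c': "(U', W') \<in> composables S" using gh UW' q_composable_iff by simp
        ultimately have "Umult U' W' \<in> UF" "a * b \<in> Umult U' W'"
          using Umult_UF(1)[OF c'] Umult_UF(3)[OF c'] by simp_all
        then have "Umult U' W' \<in> cyl n" using UF_up ab by (auto simp: cyl_def)
        then show ?thesis using n c' UW' by (auto simp: q_mult)
      qed
      ultimately show "\<exists>Z. openin (subtopology (prod_topology (gtop G) (gtop G)) (composables G)) Z \<and>
          z \<in> Z \<and> (\<forall>y\<in>Z. (case y of (g, h) \<Rightarrow> gmult G g h) \<in> V)"
        by (intro exI[of _ ?Z]) force
    qed (auto simp: topspace_G mult_closed)
  qed
qed

end

section \<open>Local triviality of the quotient map\<close>

context topological_groupoid begin

lemma range_in_gunits: "g \<in> arrows G \<Longrightarrow> grange G g \<in> gunits G"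
  using inv_closed[of g] inv_inv[of g] unfolding gunits_def gsource_def grange_def by force

lemma range_inv: "g \<in> arrows G \<Longrightarrow> grange G (ginv G g) = gsource G g"
  by (simp add: grange_def gsource_def inv_inv)

lemma continuous_range: "continuous_map (gtop G) (unit_space G) (grange G)"
proof -
  have "continuous_map (gtop G) (prod_topology (gtop G) (gtop G)) (\<lambda>g. (g, ginv G g))"
    using continuous_inv by (auto intro: continuous_map_pairedI)
  then have "continuous_map (gtop G) (subtopology (prod_topology (gtop G) (gtop G)) (composables G))
      (\<lambda>g. (g, ginv G g))"
    using inv_composable by (auto simp: continuous_map_in_subtopology topspace_gtop)
  from continuous_map_compose[OF this continuous_mult]
  have "continuous_map (gtop G) (gtop G) (grange G)"
    by (simp add: grange_def[abs_def] comp_def)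
  then show ?thesis unfolding unit_space_def
    using range_in_gunits by (auto simp: continuous_map_in_subtopology topspace_gtop)
qed

lemma continuous_source: "continuous_map (gtop G) (unit_space G) (gsource G)"
  by (rule continuous_map_eq[OF continuous_map_compose[OF continuous_inv continuous_range]])
    (simp add: topspace_gtop range_inv)

lemma openin_inv_image: assumes "openin (gtop G) W" shows "openin (gtop G) (ginv G ` W)"
proof -
  have "W \<subseteq> arrows G" using openin_subset[OF assms] topspace_gtop by simp
  then have "ginv G ` W = {g \<in> topspace (gtop G). ginv G g \<in> W}"
    using inv_closed inv_inv topspace_gtop by force
  then show ?thesis using openin_continuous_map_preimage[OF continuous_inv assms] by simp
qed

end

context algebra_with_local_units begin

lemma openin_unit_space_G: "openin (unit_space G) W \<longleftrightarrow> openin (gtop G) W \<and> W \<subseteq> gunits G"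
  by (simp add: unit_space_def openin_open_subtopology[OF openin_gunits_G])

lemma openin_unit_space_S: "openin (unit_space S) W \<longleftrightarrow> openin (gtop S) W \<and> W \<subseteq> gunits S"
  by (simp add: unit_space_def openin_open_subtopology[OF openin_gunits_S])

lemma topspace_unit_space_S: "topspace (unit_space S) = gunits S"
  using openin_subset[OF openin_gunits_S] by (simp add: unit_space_def Int_absorb1)

lemma topspace_unit_space_G: "topspace (unit_space G) = gunits G"
  using openin_subset[OF openin_gunits_G] by (simp add: unit_space_def Int_absorb1)

text \<open>
  The intersection with the units has to be formed before applying \<open>q\<close>: an element of \<open>cyl n\<close> that is
  not a unit may well be a scalar multiple of one.
\<close>

lemma openin_q_units: assumes "openin (gtop S) W" shows "openin (unit_space G) (q ` (gunits S \<inter> W))"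
proof -
  have "openin (gtop S) (gunits S \<inter> W)" using openin_gunits_S assms by blast
  then show ?thesis using openin_q_image by (auto simp: openin_unit_space_G gunits_G)
qed

lemma UF_eq_of_range:
  assumes "U \<in> UF" "V \<in> UF" "rp U = rp V" "n \<in> U" "n \<in> V" shows "U = V"
proof -
  have "Uinv U = Uinv V"
    using UF_eqI[OF Uinv_UF[OF assms(1)] Uinv_UF[OF assms(2)] _ imageI[OF assms(4)] imageI[OF assms(5)]]
      assms(1-3) by (simp add: sp_Uinv)
  then show ?thesis using Uinv_Uinv assms by metis
qed

lemma inj_on_range_cyl: "inj_on (grange G) (q ` cyl n)"
proof (rule inj_onI)
  fix x y assume "x \<in> q ` cyl n" "y \<in> q ` cyl n" and eq: "grange G x = grange G y"
  then obtain U V where UV: "x = q U" "y = q V" "U \<in> UF" "V \<in> UF" "n \<in> U" "n \<in> V"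
    by (auto simp: cyl_def)
  have "q (grange S U) = q (grange S V)" using eq UV by (simp add: q_range)
  then have "grange S U = grange S V" using q_inj_units grange_S_unit UV by blast
  then have "rp U = rp V" using grange_S_UF(3) UV by metis
  then show "x = y" using UF_eq_of_range UV by blast
qed

lemma inj_on_source_cyl: "inj_on (gsource G) (q ` cyl n)"
proof (rule inj_onI)
  fix x y assume "x \<in> q ` cyl n" "y \<in> q ` cyl n" and eq: "gsource G x = gsource G y"
  then obtain U V where UV: "x = q U" "y = q V" "U \<in> UF" "V \<in> UF" "n \<in> U" "n \<in> V"
    by (auto simp: cyl_def)
  have "q (gsource S U) = q (gsource S V)" using eq UV by (simp add: q_source)
  then have "gsource S U = gsource S V" using q_inj_units gsource_S_unit UV by blast
  then have "sp U = sp V" using gsource_S_UF(2) UV by metis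
  then show "x = y" using UF_eqI UV by blast
qed

lemma range_cyl: assumes "n \<in> N"
  shows "grange G ` (q ` cyl n) = q ` (gunits S \<inter> cyl (n * n\<^sup>\<dagger>))"
proof (intro equalityI subsetI)
  fix x assume "x \<in> grange G ` (q ` cyl n)"
  then obtain U where U: "U \<in> UF" "n \<in> U" "x = q (grange S U)" by (auto simp: cyl_def q_range)
  then have "grange S U \<in> gunits S \<inter> cyl (n * n\<^sup>\<dagger>)"
    using grange_S_unit grange_S_UF by (simp add: cyl_def)
  then show "x \<in> q ` (gunits S \<inter> cyl (n * n\<^sup>\<dagger>))" using U by blast
next
  fix x assume "x \<in> q ` (gunits S \<inter> cyl (n * n\<^sup>\<dagger>))"
  then obtain u where u: "u \<in> gunits S" "n * n\<^sup>\<dagger> \<in> u" "x = q u" by (auto simp: cyl_def)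
  obtain U where "U \<in> UF" "n \<in> U" "grange S U = u" using UF_with_range[OF u(1) assms u(2)] .
  then show "x \<in> grange G ` (q ` cyl n)" using u by (force simp: cyl_def q_range[symmetric])
qed

text \<open>
  On basic sets the image is computed by \<open>range_cyl\<close>, and \<open>n * n\<^sup>\<dagger>\<close> again gives a basic set.
\<close>

lemma open_map_range: "open_map (gtop G) (unit_space G) (grange G)"
  unfolding open_map_def
proof (intro allI impI)
  fix Z assume Z: "openin (gtop G) Z"
  show "openin (unit_space G) (grange G ` Z)"
    unfolding openin_subopen[of _ "grange G ` Z"]
  proof
    fix x assume "x \<in> grange G ` Z"
    then obtain z where z: "z \<in> Z" "x = grange G z" by blast
    then obtain U where U: "U \<in> UF" "z = q U" using openin_subset[OF Z] topspace_G arrows_G by auto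
    then have "U \<in> {U \<in> UF. q U \<in> Z}" using z by simp
    then obtain n where n: "n \<in> U" "n \<in> N" "cyl n \<subseteq> {U \<in> UF. q U \<in> Z}" "U \<in> UF"
      by (rule openin_S_cyl[OF openin_q_vimage[OF Z]])
    have "z \<in> q ` cyl n" "q ` cyl n \<subseteq> Z" using n U by (auto simp: cyl_def)
    then have "x \<in> grange G ` (q ` cyl n)" "grange G ` (q ` cyl n) \<subseteq> grange G ` Z" using z(2) by auto
    then show "\<exists>T. openin (unit_space G) T \<and> x \<in> T \<and> T \<subseteq> grange G ` Z"
      using openin_q_units[OF openin_cyl] range_cyl[OF n(2)] by auto
  qed
qed

lemma open_map_source: "open_map (gtop G) (unit_space G) (gsource G)"
  unfolding open_map_def
proof (intro allI impI)
  interpret G: topological_groupoid G by (rule topological_groupoid_G)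
  fix Z assume Z: "openin (gtop G) Z"
  have "gsource G ` Z = grange G ` (ginv G ` Z)"
    using openin_subset[OF Z] G.range_inv by (auto simp: image_image topspace_G intro!: image_cong)
  then show "openin (unit_space G) (gsource G ` Z)"
    using open_map_range G.openin_inv_image[OF Z] by (simp add: open_map_def)
qed

lemma bisection_cyl: "bisection G (q ` cyl n)"
proof -
  interpret G: topological_groupoid G by (rule topological_groupoid_G)
  note D = openin_q_image[OF openin_cyl[of n]]
  show ?thesis unfolding bisection_def
    using D homeomorphic_map_restrict_open[OF G.continuous_range open_map_range D inj_on_range_cyl]
      homeomorphic_map_restrict_open[OF G.continuous_source open_map_source D inj_on_source_cyl]
    by (intro exI[of _ "q ` cyl n"]) simp
qed

lemma q_cyl_cover: assumes "\<alpha> \<in> arrows G" obtains n where "n \<in> N" "\<alpha> \<in> q ` cyl n"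
proof -
  obtain U where U: "U \<in> UF" "\<alpha> = q U" using assms arrows_G by auto
  then obtain n where "n \<in> U" using UF_nonempty by blast
  then show ?thesis using that U UF_N by (auto simp: cyl_def)
qed

lemma etale_G: "etale_groupoid G"
proof -
  interpret G: topological_groupoid G by (rule topological_groupoid_G)
  have "\<exists>W. x \<in> W \<and> openin (gtop G) W \<and> openin (unit_space G) (grange G ` W) \<and>
      homeomorphic_map (subtopology (gtop G) W) (subtopology (unit_space G) (grange G ` W)) (grange G)"
    if "x \<in> topspace (gtop G)" for x
  proof -
    obtain n where n: "n \<in> N" "x \<in> q ` cyl n" using q_cyl_cover \<open>x \<in> _\<close> topspace_G by auto
    note D = openin_q_image[OF openin_cyl[of n]]
    show ?thesis
      using D n homeomorphic_map_restrict_open[OF G.continuous_range open_map_range D inj_on_range_cyl]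
      by blast
  qed
  then show ?thesis unfolding etale_groupoid_def local_homeo_def
    using topological_groupoid_G by blast
qed

lemma Hausdorff_unit_space_G: "Hausdorff_space (unit_space G)"
  unfolding Hausdorff_space_def topspace_unit_space_G
proof (intro allI impI)
  fix x y assume "x \<in> gunits G \<and> y \<in> gunits G \<and> x \<noteq> y"
  then obtain u v where uv: "x = q u" "y = q v" "u \<in> gunits S" "v \<in> gunits S" "u \<noteq> v"
    by (auto simp: gunits_G)
  have uvF: "u \<in> UF" "v \<in> UF" using uv unit_UF by simp_all
  have "sp u \<noteq> sp v" using unit_eqI[OF uv(3,4)] uv(5) by blast
  then obtain e f where ef: "e \<in> sp u" "f \<in> sp v" "e \<in> I" "f \<in> I" "e * f = 0"
    using points_separated[OF point_sp[OF uvF(1)] point_sp[OF uvF(2)]] by blast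
  let ?A = "q ` (gunits S \<inter> cyl e)" and ?C = "q ` (gunits S \<inter> cyl f)"
  have "cyl e \<inter> cyl f = {}" using cyl_disjoint[OF ef(3-5), of e f] ef by (simp add: I_D)
  have "disjnt ?A ?C"
    unfolding disjnt_iff
  proof (intro allI notI)
    fix z assume "z \<in> ?A \<and> z \<in> ?C"
    then obtain w w' where w: "w \<in> gunits S" "w \<in> cyl e" "w' \<in> gunits S" "w' \<in> cyl f" "z = q w" "z = q w'"
      by blast
    then have "w = w'" using q_inj_units[of w w'] by simp
    then show False using w(2,4) \<open>cyl e \<inter> cyl f = {}\<close> by blast
  qed
  moreover have "x \<in> ?A" "y \<in> ?C"
    using uv uvF unit_contains_sp[OF uv(3) ef(1)] unit_contains_sp[OF uv(4) ef(2)]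
    by (auto simp: cyl_def)
  ultimately show "\<exists>X Y. openin (unit_space G) X \<and> openin (unit_space G) Y \<and> x \<in> X \<and> y \<in> Y \<and> disjnt X Y"
    using openin_q_units[OF openin_cyl] by blast
qed

abbreviation i :: "'a set set \<times> 'r \<Rightarrow> 'a set" where "i \<equiv> Gi smul B"
abbreviation GB :: "('a set set \<times> 'r) topgroupoid_struct" where "GB \<equiv> unit_bundle G"

lemma i_q: assumes "u \<in> gunits S" shows "i (q u, t) = sact t u"
proof -
  have "(THE U. U \<in> gunits S \<and> q U = q u) = u"
    by (rule the_equality) (use q_inj_units[OF _ assms] assms in auto)
  then show ?thesis by (simp add: Gi_def)
qed

lemma gunits_S_i: "gunits S = i ` (gunits G \<times> {1})"
proof -
  have "i ` (gunits G \<times> {1}) = (\<lambda>u. i (q u, 1)) ` gunits S" by (auto simp: gunits_G)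
  also have "\<dots> = gunits S" by (simp add: i_q sact_one cong: image_cong)
  finally show ?thesis ..
qed

lemma unit_composable: "u \<in> gunits S \<Longrightarrow> (u, u) \<in> composables S"
  using unit_mult(1)[OF unit_UF] grange_of_unit by metis

lemma Umult_unit: "u \<in> gunits S \<Longrightarrow> Umult u u = u"
  using unit_mult(2)[OF unit_UF] grange_of_unit by metis

lemma hom_i: "groupoid_hom i GB S"
  unfolding groupoid_hom_def
proof
  show "i ` arrows GB \<subseteq> arrows S"
    by (auto simp: unit_bundle_def gunits_G i_q S_sel(1) sact_UF unit_UF)
  have "(i (q u, t), i (q u, s)) \<in> composables S \<and> i (q u, t * s) = gmult S (i (q u, t)) (i (q u, s))"
    if "u \<in> gunits S" "t \<in> RU" "s \<in> RU" for u t s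
    using that by (simp add: i_q composable_sact unit_composable unit_UF S_sel(2) Umult_sact Umult_unit)
  then show "\<forall>(g, h)\<in>composables GB. (i g, i h) \<in> composables S \<and> i (gmult GB g h) = gmult S (i g) (i h)"
    by (auto simp: unit_bundle_def gunits_G)
qed

lemma topspace_GB: "topspace (gtop GB) = gunits G \<times> RU"
  by (simp add: unit_bundle_def topspace_unit_space_G)

text \<open>
  Both \<open>i\<close> and the local trivialisations send \<open>(q U, t)\<close> to \<open>t U\<close>, with \<open>t\<close> from a discrete space, so that
  their continuity comes down to this statement for a fixed \<open>t\<close>.
\<close>

lemma sact_nbhd:
  assumes t: "t \<in> RU" and U: "U \<in> UF" and V: "openin (gtop S) V" "sact t U \<in> V"
  obtains m where "m \<in> U" "\<And>U'. U' \<in> cyl m \<Longrightarrow> sact t U' \<in> V"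
proof -
  obtain n where n: "n \<in> sact t U" "n \<in> N" "cyl n \<subseteq> V" "sact t U \<in> UF"
    by (rule openin_S_cyl[OF V])
  have "sact t U' \<in> V" if "U' \<in> cyl (smul (unit_inv t) n)" for U'
    using that n(3) t sact_UF by (auto simp: cyl_def smul_mem_sact)
  then show ?thesis using that n(1) t by (simp add: smul_mem_sact)
qed

lemma continuous_i: "continuous_map (gtop GB) (gtop S) i"
proof (rule continuous_map_nbhdI)
  fix x assume "x \<in> topspace (gtop GB)"
  then show "i x \<in> topspace (gtop S)"
    by (auto simp: topspace_GB gunits_G i_q topspace_S sact_UF unit_UF)
next
  fix x V assume x: "x \<in> topspace (gtop GB)" and V: "openin (gtop S) V" "i x \<in> V"
  obtain u t where ut: "x = (q u, t)" "u \<in> gunits S" "t \<in> RU"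
    using x by (auto simp: topspace_GB gunits_G)
  then have "sact t u \<in> V" using V(2) by (simp add: i_q)
  then obtain m where m: "m \<in> u" "\<And>U'. U' \<in> cyl m \<Longrightarrow> sact t U' \<in> V"
    using sact_nbhd[OF ut(3) unit_UF[OF ut(2)] V(1)] by blast
  let ?Z = "q ` (gunits S \<inter> cyl m) \<times> {t}"
  have "openin (gtop GB) ?Z"
    using openin_q_units[OF openin_cyl[of m]] ut(3)
    by (simp add: unit_bundle_def openin_prod_Times_iff)
  moreover have "x \<in> ?Z" using ut m(1) unit_UF by (auto simp: cyl_def)
  moreover have "i y \<in> V" if "y \<in> ?Z" for y using that m(2) by (auto simp: i_q)
  ultimately show "\<exists>Z. openin (gtop GB) Z \<and> x \<in> Z \<and> (\<forall>y\<in>Z. i y \<in> V)" by blast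
qed

lemma gunits_GB: "gunits GB = gunits G \<times> {1}"
proof -
  have "gsource GB (x, t) = (x, 1)" if "t \<in> RU" for x t
    using unit_inv[OF that] by (simp add: gsource_def unit_bundle_def)
  then have "gsource GB ` (gunits G \<times> RU) = (\<lambda>p. (fst p, 1)) ` (gunits G \<times> RU)"
    by (intro image_cong) auto
  also have "\<dots> = gunits G \<times> {1}" using RU_one by (auto simp: image_iff)
  finally have "gsource GB ` (gunits G \<times> RU) = gunits G \<times> {1}" .
  moreover have "gunits GB = gsource GB ` (gunits G \<times> RU)"
  proof -
    have "arrows GB = gunits G \<times> RU" by (simp add: unit_bundle_def)
    then show ?thesis by (simp only: gunits_def[of GB])
  qed
  ultimately show ?thesis by simp
qed

lemma homeomorphic_units_i: "homeomorphic_map (unit_space GB) (unit_space S) i"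
proof -
  have "homeomorphic_maps (unit_space GB) (unit_space S) i (\<lambda>u. (q u, 1))"
    unfolding homeomorphic_maps_def
  proof (intro conjI ballI)
    show "continuous_map (unit_space GB) (unit_space S) i"
      unfolding unit_space_def
      using continuous_i gunits_S_i gunits_GB
      by (auto simp: continuous_map_in_subtopology intro: continuous_map_from_subtopology)
    have "continuous_map (unit_space S) (unit_space G) q"
      unfolding unit_space_def
      using continuous_q gunits_G
      by (auto simp: continuous_map_in_subtopology intro: continuous_map_from_subtopology)
    then have "continuous_map (unit_space S) (gtop GB) (\<lambda>u. (q u, 1))"
      using RU_one by (auto simp: unit_bundle_def intro!: continuous_map_pairedI)
    then show "continuous_map (unit_space S) (unit_space GB) (\<lambda>u. (q u, 1))"
      unfolding unit_space_def[of GB]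
      by (auto simp: continuous_map_in_subtopology gunits_GB gunits_G topspace_unit_space_S)
    fix x assume "x \<in> topspace (unit_space GB)"
    then show "(q (i x), 1) = x" by (auto simp: unit_space_def gunits_GB gunits_G i_q sact_one)
  next
    fix u assume "u \<in> topspace (unit_space S)"
    then show "i (q u, 1) = u" by (simp add: topspace_unit_space_S i_q sact_one)
  qed
  then show ?thesis using homeomorphic_map_maps by blast
qed

lemma hom_q: "groupoid_hom q S G"
  unfolding groupoid_hom_def
  by (auto simp: S_sel arrows_G q_mult composables_G)

lemma homeomorphic_units_q: "homeomorphic_map (unit_space S) (unit_space G) q"
proof (rule bijective_open_imp_homeomorphic_map)
  show "continuous_map (unit_space S) (unit_space G) q"
    unfolding unit_space_def
    using continuous_q gunits_G
    by (auto simp: continuous_map_in_subtopology intro: continuous_map_from_subtopology)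
  show "open_map (unit_space S) (unit_space G) q"
    unfolding open_map_def openin_unit_space_S openin_unit_space_G
    using openin_q_image gunits_G by blast
  show "q ` topspace (unit_space S) = topspace (unit_space G)"
    by (simp add: topspace_unit_space_S topspace_unit_space_G gunits_G)
  show "inj_on q (topspace (unit_space S))"
    unfolding topspace_unit_space_S using q_inj_units by (rule inj_onI)
qed

lemma fibre_q: assumes "x \<in> gunits G" shows "i ` ({x} \<times> RU) = {\<sigma> \<in> arrows S. q \<sigma> = x}"
proof -
  obtain u where u: "u \<in> gunits S" "x = q u" using assms by (auto simp: gunits_G)
  have uF: "u \<in> UF" using u unit_UF by blast
  have "i ` ({x} \<times> RU) = (\<lambda>t. i (x, t)) ` RU" by auto
  also have "\<dots> = (\<lambda>t. sact t u) ` RU" using u by (simp add: i_q)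
  also have "\<dots> = {\<sigma> \<in> arrows S. q \<sigma> = x}"
  proof (intro equalityI subsetI)
    fix \<sigma> assume "\<sigma> \<in> (\<lambda>t. sact t u) ` RU"
    then show "\<sigma> \<in> {\<sigma> \<in> arrows S. q \<sigma> = x}"
      using sact_UF[OF _ uF] q_sact[OF _ uF] u(2) by (auto simp: S_sel(1))
  next
    fix \<sigma> assume "\<sigma> \<in> {\<sigma> \<in> arrows S. q \<sigma> = x}"
    then have "\<exists>t\<in>RU. \<sigma> = sact t u" using q_eq_iff[OF _ uF, of \<sigma>] u(2) by (simp add: S_sel(1))
    then show "\<sigma> \<in> (\<lambda>t. sact t u) ` RU" by blast
  qed
  finally show ?thesis .
qed

lemma inj_i: "inj_on i (gunits G \<times> RU)"
proof (rule inj_onI)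
  fix x y assume "x \<in> gunits G \<times> RU" "y \<in> gunits G \<times> RU" and eq: "i x = i y"
  then obtain u t v s where *: "x = (q u, t)" "y = (q v, s)" "u \<in> gunits S" "v \<in> gunits S" "t \<in> RU" "s \<in> RU"
    by (auto simp: gunits_G)
  then have e: "sact t u = sact s v" using eq by (simp add: i_q)
  then have "sp u = sp v" using sp_sact * by metis
  then have "u = v" using unit_eqI * by blast
  then show "x = y" using sact_free e * unit_UF by blast
qed

lemma inj_on_q_cyl: "inj_on q (cyl n)"
proof (rule inj_onI)
  fix U V assume UV: "U \<in> cyl n" "V \<in> cyl n" "q U = q V"
  then have UF: "U \<in> UF" "V \<in> UF" "n \<in> U" "n \<in> V" by (auto simp: cyl_def)
  obtain t where "t \<in> RU" "U = sact t V" using UV(3) q_eq_iff[OF UF(1,2)] by blast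
  then have "sp U = sp V" using sp_sact by simp
  then show "U = V" using UF_eqI UF by blast
qed

lemma i_range_mult: assumes "U \<in> UF" "t \<in> RU" shows "gmult S (i (q (grange S U), t)) U = sact t U"
  using Umult_sact[OF assms(2) RU_one unit_mult(1)[OF assms(1)]] unit_mult(2)[OF assms(1)]
  by (simp add: i_q grange_S_unit assms S_sel sact_one)

lemma mult_i_source: assumes "U \<in> UF" "t \<in> RU" shows "gmult S U (i (q (gsource S U), t)) = sact t U"
  using Umult_sact[OF RU_one assms(2) unit_mult(3)[OF assms(1)]] unit_mult(4)[OF assms(1)]
  by (simp add: i_q gsource_S_unit assms S_sel sact_one)

text \<open>
  On \<open>q ` cyl n\<close> the section picks the representative that contains \<open>n\<close>. An element of the preimage is
  then a scalar multiple of that representative, by a unique scalar because the action is free, and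
  the trivialisation sends \<open>(q U, t)\<close> to \<open>t U\<close> for \<open>U \<in> cyl n\<close>.
\<close>

lemma local_triviality:
  fixes n
  defines "D \<equiv> q ` cyl n" and "P \<equiv> the_inv_into (cyl n) q"
  shows "continuous_map (subtopology (gtop G) D) (gtop S) P" "\<forall>\<beta>\<in>D. q (P \<beta>) = \<beta>"
    "homeomorphic_map (prod_topology (subtopology (gtop G) D) (discrete_topology RU))
       (subtopology (gtop S) {\<sigma> \<in> arrows S. q \<sigma> \<in> D})
       (\<lambda>(\<beta>, t). gmult S (i (grange G \<beta>, t)) (P \<beta>))"
proof -
  have Pq: "P (q U) = U" if "U \<in> cyl n" for U
    unfolding P_def using the_inv_into_f_f[OF inj_on_q_cyl that] .
  have oD: "openin (gtop G) D" unfolding D_def using openin_q_image openin_cyl by blast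
  have tD: "topspace (subtopology (gtop G) D) = D" using openin_subset[OF oD] by (simp add: Int_absorb1)
  have cU: "U \<in> UF" if "U \<in> cyl n" for U using that by (simp add: cyl_def)
  show "\<forall>\<beta>\<in>D. q (P \<beta>) = \<beta>" unfolding D_def using Pq by auto
  show "continuous_map (subtopology (gtop G) D) (gtop S) P"
  proof (rule continuous_map_nbhdI)
    fix x assume "x \<in> topspace (subtopology (gtop G) D)"
    then show "P x \<in> topspace (gtop S)" unfolding tD D_def using Pq cU by (auto simp: topspace_S)
  next
    fix x V assume x: "x \<in> topspace (subtopology (gtop G) D)" and V: "openin (gtop S) V" "P x \<in> V"
    let ?Z = "q ` (cyl n \<inter> V)"
    have "openin (gtop G) ?Z" using openin_q_image openin_cyl V by blast
    moreover have "?Z \<subseteq> D" unfolding D_def by blast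
    ultimately have "openin (subtopology (gtop G) D) ?Z" using oD openin_open_subtopology by blast
    moreover have "x \<in> ?Z" using x V(2) Pq unfolding tD D_def by auto
    moreover have "\<forall>y\<in>?Z. P y \<in> V" using Pq by auto
    ultimately show "\<exists>Z. openin (subtopology (gtop G) D) Z \<and> x \<in> Z \<and> (\<forall>y\<in>Z. P y \<in> V)" by blast
  qed
  let ?X = "prod_topology (subtopology (gtop G) D) (discrete_topology RU)"
  let ?E = "{\<sigma> \<in> arrows S. q \<sigma> \<in> D}"
  let ?\<Phi> = "\<lambda>(\<beta>, t). gmult S (i (grange G \<beta>, t)) (P \<beta>)"
  have \<Phi>: "?\<Phi> (q U, t) = sact t U" if "U \<in> cyl n" "t \<in> RU" for U t
    using that cU by (simp add: Pq q_range i_range_mult)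
  have tX: "topspace ?X = D \<times> RU" by (simp add: tD[simplified])
  have E: "?E = {U \<in> UF. q U \<in> D}" by (simp add: S_sel)
  have oE: "openin (gtop S) ?E" unfolding E by (rule openin_q_vimage[OF oD])
  have tE: "topspace (subtopology (gtop S) ?E) = ?E"
    using openin_subset[OF oE] by (simp add: Int_absorb1)
  have im: "?\<Phi> ` (D \<times> RU) = ?E"
  proof (intro equalityI subsetI)
    fix \<sigma> assume "\<sigma> \<in> ?\<Phi> ` (D \<times> RU)"
    then obtain U t where U: "U \<in> cyl n" "t \<in> RU" "\<sigma> = ?\<Phi> (q U, t)" unfolding D_def by auto
    then have "\<sigma> = sact t U" using \<Phi> by simp
    then show "\<sigma> \<in> ?E" using U cU sact_UF q_sact unfolding D_def by (auto simp: S_sel(1))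
  next
    fix \<sigma> assume "\<sigma> \<in> ?E"
    then obtain U where U: "U \<in> cyl n" "\<sigma> \<in> UF" "q \<sigma> = q U"
      unfolding D_def by (auto simp: S_sel(1))
    then obtain t where "t \<in> RU" "\<sigma> = sact t U" using q_eq_iff[OF U(2) cU[OF U(1)]] by blast
    then have "\<sigma> = ?\<Phi> (q U, t)" "(q U, t) \<in> D \<times> RU" using \<Phi> U unfolding D_def by auto
    then show "\<sigma> \<in> ?\<Phi> ` (D \<times> RU)" by (rule image_eqI)
  qed
  show "homeomorphic_map ?X (subtopology (gtop S) ?E) ?\<Phi>"
  proof (rule bijective_open_imp_homeomorphic_map)
    have "continuous_map ?X (gtop S) ?\<Phi>"
    proof (rule continuous_map_nbhdI)
      fix x assume "x \<in> topspace ?X"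
      then have "?\<Phi> x \<in> ?E" unfolding tX im[symmetric] by (rule imageI)
      then show "?\<Phi> x \<in> topspace (gtop S)" unfolding E topspace_S by blast
    next
      fix x V assume x: "x \<in> topspace ?X" and V: "openin (gtop S) V" "?\<Phi> x \<in> V"
      obtain U t where U: "x = (q U, t)" "U \<in> cyl n" "t \<in> RU"
        using x[unfolded tX] unfolding D_def by blast
      have "sact t U \<in> V" using \<Phi>[OF U(2,3)] V(2) U(1) by simp
      then obtain m where m: "m \<in> U" "\<And>U'. U' \<in> cyl m \<Longrightarrow> sact t U' \<in> V"
        using sact_nbhd[OF U(3) cU[OF U(2)] V(1)] by blast
      let ?Z = "q ` (cyl n \<inter> cyl m)"
      have "openin (gtop G) ?Z" using openin_q_image openin_cyl by blast
      moreover have "?Z \<subseteq> D" unfolding D_def by blast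
      ultimately have "openin ?X (?Z \<times> {t})"
        using oD U(3) by (simp add: openin_prod_Times_iff openin_open_subtopology)
      moreover have "x \<in> ?Z \<times> {t}" using U m(1) by (auto simp: cyl_def)
      moreover have "?\<Phi> y \<in> V" if y: "y \<in> ?Z \<times> {t}" for y
      proof -
        obtain U' where U': "y = (q U', t)" "U' \<in> cyl n" "U' \<in> cyl m" using y by blast
        then show ?thesis using \<Phi>[OF U'(2) U(3)] m(2)[OF U'(3)] by simp
      qed
      ultimately show "\<exists>Z. openin ?X Z \<and> x \<in> Z \<and> (\<forall>y\<in>Z. ?\<Phi> y \<in> V)" by blast
    qed
    then show "continuous_map ?X (subtopology (gtop S) ?E) ?\<Phi>"
      using im unfolding continuous_map_in_subtopology tX by blast
    show "open_map ?X (subtopology (gtop S) ?E) ?\<Phi>"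
      unfolding open_map_def
    proof (intro allI impI)
      fix Y assume Y: "openin ?X Y"
      have YX: "Y \<subseteq> D \<times> RU" using openin_subset[OF Y] unfolding tX .
      have "openin (gtop S) (?\<Phi> ` Y)"
        unfolding openin_subopen[of _ "?\<Phi> ` Y"]
      proof
        fix \<sigma> assume "\<sigma> \<in> ?\<Phi> ` Y"
        then obtain y where y: "y \<in> Y" "\<sigma> = ?\<Phi> y" by blast
        then obtain U t where U: "y = (q U, t)" "U \<in> cyl n" "t \<in> RU" using YX unfolding D_def by blast
        obtain A C where AC: "openin (subtopology (gtop G) D) A" "q U \<in> A" "t \<in> C" "A \<times> C \<subseteq> Y"
          using Y y(1) U(1) unfolding openin_prod_topology_alt by meson
        have "openin (gtop G) A" using AC(1) oD openin_open_subtopology by blast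
        then have W: "openin (gtop S) (cyl n \<inter> {U \<in> UF. q U \<in> A})"
          using openin_q_vimage openin_cyl by blast
        let ?T = "sact t ` (cyl n \<inter> {U \<in> UF. q U \<in> A})"
        have "\<sigma> = sact t U" using \<Phi>[OF U(2,3)] y(2) U(1) by simp
        then have "\<sigma> \<in> ?T" using U(2) cU AC(2) by blast
        moreover have "?T \<subseteq> ?\<Phi> ` Y"
        proof
          fix \<tau> assume "\<tau> \<in> ?T"
          then obtain U' where U': "U' \<in> cyl n" "q U' \<in> A" "\<tau> = sact t U'" by blast
          have "(q U', t) \<in> Y" using U'(2) AC(3,4) by blast
          moreover have "\<tau> = ?\<Phi> (q U', t)" using \<Phi>[OF U'(1) U(3)] U'(3) by simp
          ultimately show "\<tau> \<in> ?\<Phi> ` Y" by (rule rev_image_eqI)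
        qed
        ultimately show "\<exists>T. openin (gtop S) T \<and> \<sigma> \<in> T \<and> T \<subseteq> ?\<Phi> ` Y"
          using openin_sact[OF U(3) W] by blast
      qed
      moreover have "?\<Phi> ` Y \<subseteq> ?E" using image_mono[OF YX, of ?\<Phi>] unfolding im .
      ultimately show "openin (subtopology (gtop S) ?E) (?\<Phi> ` Y)"
        using oE openin_open_subtopology by blast
    qed
    show "?\<Phi> ` topspace ?X = topspace (subtopology (gtop S) ?E)" unfolding tX tE by (rule im)
    show "inj_on ?\<Phi> (topspace ?X)" unfolding tX
    proof (rule inj_onI)
      fix x y assume "x \<in> D \<times> RU" "y \<in> D \<times> RU" and eq: "?\<Phi> x = ?\<Phi> y"
      then obtain U t V s where *: "x = (q U, t)" "U \<in> cyl n" "t \<in> RU" "y = (q V, s)" "V \<in> cyl n" "s \<in> RU"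
        unfolding D_def by blast
      have e: "sact t U = sact s V" using eq \<Phi>[OF *(2,3)] \<Phi>[OF *(5,6)] *(1,4) by simp
      then have "q U = q V" using q_sact[OF *(3) cU[OF *(2)]] q_sact[OF *(6) cU[OF *(5)]] by simp
      then have UV: "U = V" using inj_onD[OF inj_on_q_cyl _ *(2,5)] by blast
      then have "t = s" using sact_free[OF *(3,6) cU[OF *(2)]] e by simp
      then show "x = y" using UV * by simp
    qed
  qed
qed

lemma discrete_twist_S_G: "discrete_twist i S q G"
  unfolding discrete_twist_def
proof (intro conjI)
  show "\<forall>\<alpha>\<in>arrows G. \<exists>D P. \<alpha> \<in> D \<and> openin (gtop G) D \<and> bisection G D \<and>
      continuous_map (subtopology (gtop G) D) (gtop S) P \<and> (\<forall>\<beta>\<in>D. q (P \<beta>) = \<beta>) \<and>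
      homeomorphic_map (prod_topology (subtopology (gtop G) D) (discrete_topology RU))
        (subtopology (gtop S) {\<sigma> \<in> arrows S. q \<sigma> \<in> D})
        (\<lambda>(\<beta>, t). gmult S (i (grange G \<beta>, t)) (P \<beta>))"
  proof
    fix \<alpha> assume "\<alpha> \<in> arrows G"
    then obtain n where n: "n \<in> N" "\<alpha> \<in> q ` cyl n" by (rule q_cyl_cover)
    show "\<exists>D P. \<alpha> \<in> D \<and> openin (gtop G) D \<and> bisection G D \<and>
      continuous_map (subtopology (gtop G) D) (gtop S) P \<and> (\<forall>\<beta>\<in>D. q (P \<beta>) = \<beta>) \<and>
      homeomorphic_map (prod_topology (subtopology (gtop G) D) (discrete_topology RU))
        (subtopology (gtop S) {\<sigma> \<in> arrows S. q \<sigma> \<in> D})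
        (\<lambda>(\<beta>, t). gmult S (i (grange G \<beta>, t)) (P \<beta>))"
      by (rule exI[of _ "q ` cyl n"], rule exI[of _ "the_inv_into (cyl n) q"], intro conjI)
        (rule n(2) openin_q_image[OF openin_cyl] bisection_cyl local_triviality)+
  qed
  show "\<forall>\<sigma>\<in>arrows S. \<forall>t\<in>RU. gmult S (i (q (grange S \<sigma>), t)) \<sigma> = gmult S \<sigma> (i (q (gsource S \<sigma>), t))"
    by (simp add: S_sel(1) i_range_mult mult_i_source)
  show "\<forall>x\<in>gunits G. i ` ({x} \<times> RU) = {\<sigma> \<in> arrows S. q \<sigma> = x}" using fibre_q by blast
  show "q ` arrows S = arrows G" by (simp add: S_sel(1) arrows_G)
qed (rule etale_G Hausdorff_unit_space_G topological_groupoid_S gunits_S_i hom_i continuous_i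
    homeomorphic_units_i hom_q continuous_q homeomorphic_units_q inj_i)+

section \<open>The Hausdorff property\<close>

text \<open>
  A point decides, for each of the finitely many idempotents in a linear combination, whether to pass
  below that idempotent or below its complement; what remains is a single scalar.
\<close>

lemma span_scalar_at_point:
  assumes b: "b \<in> r_span smul I" and x: "point x"
  obtains c f where "f \<in> x" "b * f = smul c f"
proof -
  obtain F c where F: "finite F" "F \<subseteq> I" "b = (\<Sum>a\<in>F. smul (c a) a)" using b by (auto simp: r_span_def)
  have "\<exists>d. \<exists>f\<in>x. (\<Sum>a\<in>F. smul (c a) a) * f = smul d f"
    using F(1,2)
  proof (induction F)
    case empty
    obtain f where "f \<in> x" using pointD(2)[OF x] by blast
    moreover have "smul 0 f = 0" using smul_diff_left[of 0 0 f] by simp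
    ultimately show ?case by (intro exI[of _ 0] bexI[of _ f]) simp_all
  next
    case (insert e F)
    then obtain d f where f: "f \<in> x" "(\<Sum>a\<in>F. smul (c a) a) * f = smul d f" by auto
    have I: "f \<in> I" "e \<in> I" using f(1) pointD(1)[OF x] insert.prems by auto
    have sum: "(\<Sum>a\<in>insert e F. smul (c a) a) * (f * g) = smul (c e) (e * (f * g)) + smul d (f * g)" for g
    proof -
      have "(\<Sum>a\<in>F. smul (c a) a) * (f * g) = smul d (f * g)"
        using f(2) by (simp add: scale_mult_left flip: mult.assoc)
      then show ?thesis using insert.hyps by (simp add: distrib_right scale_mult_left)
    qed
    consider "f * e \<in> x" | "f - f * e \<in> x" using pointD(6)[OF x f(1) I(2)] by blast
    then show ?case
    proof cases
      case 1
      have "e * (f * e) = f * e" using I I_commute[of f e] by (simp add: I_idem_left)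
      then have "(\<Sum>a\<in>insert e F. smul (c a) a) * (f * e) = smul (c e + d) (f * e)"
        using sum[of e] by (simp add: scale_left_distrib)
      then show ?thesis using 1 by blast
    next
      case 2
      have "f * (f - f * e) = f - f * e" using I by (simp add: right_diff_distrib I_D I_idem_left)
      then have "(\<Sum>a\<in>insert e F. smul (c a) a) * (f - f * e) = smul d (f - f * e)"
        using sum[of "f - f * e"] diff_I_annihilates(2)[OF I] by (simp add: smul_zero_right)
      then show ?thesis using 2 by blast
    qed
  qed
  then show ?thesis using that F(3) by blast
qed

context
  fixes P
  assumes span_B: "B = r_span smul I"
    and expectation: "conditional_expectation smul B P"
    and implemented: "implemented_by_idempotents B P"
begin

lemma P_B: "P a \<in> B" "b \<in> B \<Longrightarrow> P b = b" "P (smul t a) = smul t (P a)"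
  using expectation by (auto simp: conditional_expectation_def)

text \<open>
  The bimodule property has a factor from \<open>B\<close> on both sides; a local unit for \<open>a\<close> and \<open>P a\<close> serves as the
  other one.
\<close>

lemma P_mult_right: assumes "b \<in> B" shows "P (a * b) = P a * b"
proof -
  obtain e where e: "e \<in> I" "e * a = a" "e * P a = P a" by (rule local_unit[of a "P a"])
  have "P (e * a * b) = e * P a * b"
    using expectation e(1) assms by (auto simp: conditional_expectation_def I_D)
  then show ?thesis using e by simp
qed

lemma P_mult_left: assumes "b \<in> B" shows "P (b * a) = b * P a"
proof -
  obtain e where e: "e \<in> I" "a * e = a" "P a * e = P a" by (rule local_unit[of a "P a"])
  have "P (b * a * e) = b * P a * e"
    using expectation e(1) assms by (auto simp: conditional_expectation_def I_D)
  then show ?thesis using e by (simp add: mult.assoc)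
qed

text \<open>
  With \<open>k = (c f)\<^sup>\<dagger>\<close>, the idempotent \<open>c f * k\<close> is fixed by \<open>P\<close>, hence equal to \<open>c f * P k\<close>, where now all factors
  lie in \<open>B\<close>. Near the point, \<open>f * P k\<close> is a scalar \<open>d\<close>, and (WT) turns the resulting identity into
  \<open>c * d = 1\<close>. The hypothesis on the range point ensures that \<open>c f * k\<close> belongs to the same point as \<open>f\<close>.
\<close>

lemma scalar_of_isotropy_unit:
  assumes T: "T \<in> UF" "rp T = sp T" and f: "f \<in> sp T" "smul c f \<in> T"
  shows "c \<in> RU"
proof -
  have x: "point (sp T)" using point_sp[OF T(1)] .
  have fI: "f \<in> I" "f \<in> B" using f(1) by (auto simp: sp_def I_D)
  define k where "k = (smul c f)\<^sup>\<dagger>"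
  define g where "g = smul c f * k"
  have g: "g \<in> sp T" unfolding g_def k_def using UF_dagger_mem_rp[OF T(1) f(2)] T(2) by simp
  then have gI: "g \<in> I" "g \<in> B" by (auto simp: sp_def I_D)
  have "P g = smul c f * P k" unfolding g_def by (rule P_mult_left[OF smul_B[OF fI(2)]])
  then have gP: "g = smul c (f * P k)" using P_B(2)[OF gI(2)] by (simp add: scale_mult_left)
  have "f * P k \<in> r_span smul I" using mult_B[OF fI(2) P_B(1)] span_B by simp
  then obtain d h where h: "h \<in> sp T" "f * P k * h = smul d h" by (rule span_scalar_at_point[OF _ x])
  have hI: "h \<in> I" using h(1) by (simp add: sp_def)
  have gh: "g * h = smul (c * d) h"
    using gP h(2) by (metis scale_mult_left scale_scale)
  have ghx: "g * h \<in> sp T" using pointD(4)[OF x g h(1)] .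
  have "g * h = g * (g * h)" using gI(1) by (simp add: I_idem_left)
  also have "\<dots> = smul (c * d) (g * h)" unfolding gh[symmetric] by (metis gh scale_mult_right)
  finally have "smul (c * d - 1) (g * h) = 0" by (simp add: smul_diff_left scale_one)
  moreover have "g * h \<in> I - {0}" using ghx pointD(1,3)[OF x] by blast
  ultimately have "c * d - 1 = 0" using WT_B unfolding WT_def by blast
  then show ?thesis using RU_I[of c d] by simp
qed

text \<open>
  Since \<open>U\<close> and \<open>W\<close> have the same source and range points, their quotient \<open>T\<close> is an isotropy element. The
  expectation detects whether \<open>T\<close> is a scalar multiple of a unit, through the idempotent that
  implements it on \<open>k \<in> T\<close>.
\<close>

lemma separate_parallel:
  assumes U: "U \<in> UF" and W: "W \<in> UF" and eq: "sp U = sp W" "rp U = rp W" and ne: "q U \<noteq> q W"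
  obtains n m where "n \<in> U" "m \<in> W" "disjnt (q ` cyl n) (q ` cyl m)"
proof -
  have c: "(Uinv U, W) \<in> composables S" using U W eq by (simp add: composable_iff Uinv_UF sp_Uinv)
  define T where "T = Umult (Uinv U) W"
  have T: "T \<in> UF" "sp T = sp U" "rp T = sp U"
    unfolding T_def using Umult_UF[OF c] rp_Umult[OF c] U eq by (auto simp: rp_Uinv)
  have x: "point (sp U)" using point_sp[OF U] .
  obtain n m where nm: "n \<in> U" "m \<in> W" using UF_nonempty[OF U] UF_nonempty[OF W] by blast
  have N: "n \<in> N" "m \<in> N" using nm UF_N[OF U] UF_N[OF W] by auto
  define k where "k = n\<^sup>\<dagger> * m"
  have k: "k \<in> T" unfolding T_def k_def using Umult_UF(3)[OF c] nm by blast
  have kN: "k \<in> N" using UF_N[OF T(1) k] .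
  obtain e where e: "e \<in> I" "P k = k * e" using implemented kN unfolding implemented_by_idempotents_def by blast
  have "e \<notin> sp U"
  proof
    assume eU: "e \<in> sp U"
    then have ke: "k * e \<in> T" using sp_mult_mem[OF T(1) k] T(2) by simp
    have "k * e \<in> r_span smul I" using P_B(1)[of k] e(2) span_B by simp
    then obtain c f where f: "f \<in> sp U" "k * e * f = smul c f" by (rule span_scalar_at_point[OF _ x])
    have cf: "smul c f \<in> T" using sp_mult_mem[OF T(1) ke, of f] f T(2) by simp
    have cR: "c \<in> RU" using scalar_of_isotropy_unit[OF T(1) _ _ cf] T(2,3) f(1) by simp
    let ?u = "gsource S U"
    have "f \<in> ?u" using unit_contains_sp[OF gsource_S_unit[OF U]] gsource_S_UF(2)[OF U] f(1) by simp
    then have "smul c f \<in> sact c ?u" by blast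
    moreover have "sp T = sp (sact c ?u)" using T(2) sp_sact[OF cR] gsource_S_UF(2)[OF U] by simp
    ultimately have "T = sact c ?u"
      using UF_eqI[OF T(1) sact_UF[OF cR gsource_S_UF(1)[OF U]] _ cf] by simp
    then have "Umult U T = sact c U"
      using Umult_sact[OF RU_one cR unit_mult(3)[OF U]] unit_mult(4)[OF U] by (simp add: sact_one)
    \<comment> \<open>Left multiplication by \<open>U\<close> undoes the inverse in the definition of \<open>T\<close>.\<close>
    moreover have "Umult U T = W"
      using inv_mult_cancel_S[OF c] Uinv_Uinv[OF U] unfolding T_def by simp
    ultimately show False using ne q_sact[OF cR U] by simp
  qed
  \<comment> \<open>Away from the support of \<open>P k\<close>: on \<open>g\<close> the expectation of \<open>k\<close> vanishes.\<close>
  define g0 where "g0 = k\<^sup>\<dagger> * k"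
  define g where "g = g0 - g0 * e"
  have g0: "g0 \<in> sp U" unfolding g0_def using UF_dagger_mem_sp[OF T(1) k] T(2) by simp
  then have g0I: "g0 \<in> I" by (simp add: sp_def)
  have g: "g \<in> sp U" "g \<in> I" "e * g = 0"
    unfolding g_def using pointD(6)[OF x g0 e(1)] point_mult_D[OF x _ g0I e(1)] \<open>e \<notin> sp U\<close>
      diff_I[OF g0I e(1)] diff_I_annihilates(2)[OF g0I e(1)] by blast+
  have "q U' \<noteq> q W'" if U': "U' \<in> cyl (n * g)" and W': "W' \<in> cyl (m * g)" for U' W'
  proof
    assume "q U' = q W'"
    have UF': "U' \<in> UF" "n * g \<in> U'" "W' \<in> UF" "m * g \<in> W'" using U' W' by (auto simp: cyl_def)
    obtain t where t: "t \<in> RU" "U' = sact t W'"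
      using \<open>q U' = q W'\<close> q_eq_iff[OF UF'(1,3)] by blast
    then have "smul t (m * g) \<in> U'" using UF'(4) by blast
    then obtain h where h: "h \<in> sp U'" "n * g * h = smul t (m * g) * h"
      using UF_common[OF UF'(1,2)] by blast
    have hI: "h \<in> I" using h(1) by (simp add: sp_def)
    have ngh: "n * g * h \<noteq> 0" using sp_mult_mem[OF UF'(1,2) h(1)] UF_nonzero[OF UF'(1)] by metis
    have ghB: "g * h \<in> B" using mult_I[OF g(2) hI] I_D(1) by blast
    \<comment> \<open>The left side is a nonzero idempotent fixed by \<open>P\<close>, the right side is killed by \<open>P\<close>.\<close>
    have "n\<^sup>\<dagger> * (n * g * h) = smul t (k * (g * h))"
      unfolding h(2) k_def by (simp add: scale_mult_left scale_mult_right mult.assoc)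
    moreover have "P (k * (g * h)) = k * (e * g) * h"
      using P_mult_right[OF ghB, of k] e(2) by (simp add: mult.assoc)
    ultimately have "P (n\<^sup>\<dagger> * (n * g * h)) = 0" using g(3) P_B(3) by (simp add: smul_zero_right)
    moreover have "n\<^sup>\<dagger> * (n * g * h) \<in> B"
      using mult_B[OF _ ghB, of "n\<^sup>\<dagger> * n"] dagger_I(1)[OF N(1)] I_D(1) by (simp add: mult.assoc)
    ultimately have "n\<^sup>\<dagger> * (n * g * h) = 0" using P_B(2) by simp
    then have "n * (n\<^sup>\<dagger> * (n * g * h)) = 0" by simp
    then have "n * n\<^sup>\<dagger> * n * g * h = 0" by (simp add: mult.assoc)
    then show False using ngh dagger_mult_cancel(2)[OF N(1)] by simp
  qed
  then have "disjnt (q ` cyl (n * g)) (q ` cyl (m * g))" unfolding disjnt_iff by blast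
  moreover have "n * g \<in> U" "m * g \<in> W" using sp_mult_mem[OF U nm(1)] sp_mult_mem[OF W nm(2)] g(1) eq by auto
  ultimately show ?thesis using that by blast
qed

lemma separate_sources:
  assumes U: "U \<in> UF" and W: "W \<in> UF" and ne: "sp U \<noteq> sp W"
  obtains n m where "n \<in> U" "m \<in> W" "disjnt (q ` cyl n) (q ` cyl m)"
proof -
  obtain e f where ef: "e \<in> sp U" "f \<in> sp W" "e \<in> I" "f \<in> I" "e * f = 0"
    using points_separated[OF point_sp[OF U] point_sp[OF W] ne] .
  obtain n m where nm: "n \<in> U" "m \<in> W" using UF_nonempty[OF U] UF_nonempty[OF W] by blast
  have "q U' \<noteq> q W'" if U': "U' \<in> cyl (n * e)" and W': "W' \<in> cyl (m * f)" for U' W'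
  proof
    assume eq: "q U' = q W'"
    have UF': "U' \<in> UF" "W' \<in> UF" using U' W' by (auto simp: cyl_def)
    obtain t where "t \<in> RU" "U' = sact t W'" using eq q_eq_iff[OF UF'] by blast
    then have "sp U' = sp W'" using sp_sact by simp
    moreover have "e \<in> sp U'" "f \<in> sp W'"
      using U' W' ef(3,4) I_idem_right unfolding sp_def cyl_def by auto
    ultimately show False using pointD(3,4)[OF point_sp[OF UF'(1)]] ef(5) by metis
  qed
  then have "disjnt (q ` cyl (n * e)) (q ` cyl (m * f))" unfolding disjnt_iff by blast
  then show ?thesis using that sp_mult_mem[OF U nm(1) ef(1)] sp_mult_mem[OF W nm(2) ef(2)] by blast
qed

lemma separate:
  assumes U: "U \<in> UF" and W: "W \<in> UF" and ne: "q U \<noteq> q W"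
  shows "\<exists>n\<in>U. \<exists>m\<in>W. disjnt (q ` cyl n) (q ` cyl m)"
proof -
  consider "sp U \<noteq> sp W" | "rp U \<noteq> rp W" | "sp U = sp W" "rp U = rp W" by blast
  then show ?thesis
  proof cases
    case 1
    then show ?thesis using separate_sources[OF U W] by metis
  next
    case 2
    then have "sp (Uinv U) \<noteq> sp (Uinv W)" using sp_Uinv U W by simp
    then obtain n m where nm: "n \<in> Uinv U" "m \<in> Uinv W" "disjnt (q ` cyl n) (q ` cyl m)"
      by (rule separate_sources[OF Uinv_UF[OF U] Uinv_UF[OF W]])
    have N: "n \<in> N" "m \<in> N"
      using UF_N[OF Uinv_UF[OF U] nm(1)] UF_N[OF Uinv_UF[OF W] nm(2)] .
    have inv: "ginv G z \<in> q ` cyl k" if "z \<in> q ` cyl (k\<^sup>\<dagger>)" "k \<in> N" for z k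
    proof -
      obtain X where X: "z = q X" "X \<in> UF" "k\<^sup>\<dagger> \<in> X" using \<open>z \<in> _\<close> by (auto simp: cyl_def)
      have "k \<in> Uinv X" using X(3) dagger_dagger[OF \<open>k \<in> N\<close>] by (metis imageI)
      then show ?thesis using X by (auto simp: q_inv cyl_def Uinv_UF)
    qed
    have "disjnt (q ` cyl (n\<^sup>\<dagger>)) (q ` cyl (m\<^sup>\<dagger>))"
      unfolding disjnt_iff
    proof (intro allI notI)
      fix z assume "z \<in> q ` cyl (n\<^sup>\<dagger>) \<and> z \<in> q ` cyl (m\<^sup>\<dagger>)"
      then have "ginv G z \<in> q ` cyl n" "ginv G z \<in> q ` cyl m" using inv N by simp_all
      then show False using nm(3) by (simp add: disjnt_iff)
    qed
    moreover have "n\<^sup>\<dagger> \<in> U" "m\<^sup>\<dagger> \<in> W"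
      using nm(1,2) N Uinv_mem[OF U dagger_N] Uinv_mem[OF W dagger_N] by (simp_all add: dagger_dagger)
    ultimately show ?thesis by blast
  next
    case 3
    then show ?thesis using separate_parallel[OF U W _ _ ne] by metis
  qed
qed

lemma Hausdorff_G: "Hausdorff_space (gtop G)"
  unfolding Hausdorff_space_def topspace_G
proof (intro allI impI)
  fix x y assume "x \<in> arrows G \<and> y \<in> arrows G \<and> x \<noteq> y"
  then obtain U W where UW: "x = q U" "y = q W" "U \<in> UF" "W \<in> UF" "q U \<noteq> q W" by (auto simp: arrows_G)
  then obtain n m where nm: "n \<in> U" "m \<in> W" "disjnt (q ` cyl n) (q ` cyl m)" using separate by blast
  have "x \<in> q ` cyl n" "y \<in> q ` cyl m" using UW nm by (auto simp: cyl_def)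
  then show "\<exists>A C. openin (gtop G) A \<and> openin (gtop G) C \<and> x \<in> A \<and> y \<in> C \<and> disjnt A C"
    using openin_q_image[OF openin_cyl] nm(3) by blast
qed

end

end

theorem theorem5p6:
  fixes smul :: "'r::{comm_ring,comm_monoid_mult} \<Rightarrow> 'a::ring \<Rightarrow> 'a"
    and B :: "'a set"
  assumes "r_algebra smul"
    and "commutative_subalgebra smul B"
    and "WT smul B"
    and "local_units (idems B)"
    and "B = r_span smul (idems B)"
  shows "discrete_twist (Gi smul B) (Sigma_groupoid B) (Gq smul B) (G_groupoid smul B) \<and>
    (algebraic_quasi_Cartan_pair smul B \<longrightarrow> Hausdorff_space (gtop (G_groupoid smul B)))"
proof -
  interpret r_algebra smul by (rule assms(1))
  have "smul (- 1) b = - b" for b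
  proof -
    have "smul (- 1) b + smul 1 b = smul (- 1 + 1) b" by (simp only: scale_left_distrib)
    moreover have "smul 0 b = 0" using scale_left_distrib[of 0 0 b] by simp
    ultimately show ?thesis by (simp add: scale_one eq_neg_iff_add_eq_0)
  qed
  then have "- b \<in> B" if "b \<in> B" for b
    using that assms(2) unfolding commutative_subalgebra_def by metis
  then interpret algebra_with_local_units smul B
    using assms(2-4) by unfold_locales (auto simp: commutative_subalgebra_def)
  show ?thesis
    using discrete_twist_S_G Hausdorff_G[OF assms(5)]
    unfolding algebraic_quasi_Cartan_pair_def by blast
qed

end
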